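(* Let $x$ and $y$ be two non-zero real numbers. There exist exactly two (up to similarities) planar non-collinear central configurations $(\vec r_1,\vec r_2,\vec r_3,\vec r_4)$ with non-zero multiplier $\xi$ for four bodies with masses $(m_1,m_2,m_3,m_4)=(x,-x,y,-y)$. Each of them is a trapezoid in which the bodies with masses $x$ and $-x$ (bodies $1$ and $2$) are the endpoints of one of the two parallel sides (bases) and the bodies with masses $y$ and $-y$ (bodies $3$ and $4$) are the endpoints of the other, and this trapezoid is semi-balanced. The two configurations are symmetrical to each other with respect to a line orthogonal to the bases, i.e. up to similarities, one is obtained from the other by taking the mirror image of the trapezoid in a line orthogonal to the bases and exchanging the two bodies located at the endpoints of each base (bodies $1$ and $2$, and bodies $3$ and $4$). If $x=y$ or $x=-y$, both configurations are rhombi. If $|x|\ne|y|$, then of the two bases, the one whose endpoints have masses of larger absolute value is the shorter one. Two bodies lying on the same diagonal have masses with the same sign.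
   Context: Consider $N$ point bodies with non-zero real masses $m_1,\dots,m_N$ (positive or negative) at pairwise distinct positions $\vec r_1,\dots,\vec r_N$ in a Euclidean vector space. Define the accelerations $$\vec\gamma_i=\sum_{j\ne i} m_j\frac{\vec r_j-\vec r_i}{\|\vec r_j-\vec r_i\|^3}.$$ The configuration is called central with multiplier $\xi\in\mathbb{R}$ if $\vec\gamma_j-\vec\gamma_i=\xi(\vec r_j-\vec r_i)$ for all $i,j$. It is planar non-collinear if its points lie in a plane (identified with $\mathbb{R}^2$) but not on a line. Bodies are labelled: two configurations in $\mathbb{R}^2$ are the same up to similarities if some similarity of the plane (a composition of a translation, a rotation or reflection, and a homothety with non-zero ratio; orientation reversal is allowed) maps $\vec r_i$ to $\vec r_i'$ for every $i$. In the plane, the band of a line segment $[\vec a,\vec b]$ is the set of all $\vec r+\vec u$ with $\vec r\in[\vec a,\vec b]$ and $\vec u\perp \vec b-\vec a$. The bands $\mathscr{B},\mathscr{B}'$ of a trapezoid are the bands of its two bases. The trapezoid is balanced if $\mathscr{B}\subset\mathscr{B}'$ or $\mathscr{B}'\subset\mathscr{B}$, unbalanced if $\mathscr{B}\cap\mathscr{B}'=\emptyset$, and semi-balanced otherwise. Parallelograms count as trapezoids; here the bases are the segments $[\vec r_1,\vec r_2]$ and $[\vec r_3,\vec r_4]$. *)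

theory Defs
  imports "HOL-Analysis.Analysis"
begin

text \<open>
  Labelled configurations are families of points indexed by a finite type. For four bodies the
  index type is \<^typ>\<open>4\<close>, whose elements are 1, 2, 3 and 4 (with 4 = 0).
\<close>

lemma vector_4 [simp]:
  "(vector [a, b, c, d] :: 'a::zero ^ 4) $ 1 = a"
  "(vector [a, b, c, d] :: 'a::zero ^ 4) $ 2 = b"
  "(vector [a, b, c, d] :: 'a::zero ^ 4) $ 3 = c"
  "(vector [a, b, c, d] :: 'a::zero ^ 4) $ 4 = d"
  unfolding vector_def by simp_all


section \<open>Central configurations\<close>

definition acceleration :: "real ^ 'n \<Rightarrow> 'a::euclidean_space ^ 'n \<Rightarrow> 'n::finite \<Rightarrow> 'a" where
  "acceleration m r i =
     (\<Sum>j \<in> UNIV - {i}. (m $ j / norm (r $ j - r $ i) ^ 3) *\<^sub>R (r $ j - r $ i))"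

definition central_with_multiplier ::
  "real ^ 'n \<Rightarrow> 'a::euclidean_space ^ 'n::finite \<Rightarrow> real \<Rightarrow> bool" where
  "central_with_multiplier m r \<xi> \<longleftrightarrow>
     inj (\<lambda>i. r $ i) \<and>
     (\<forall>i j. acceleration m r j - acceleration m r i = \<xi> *\<^sub>R (r $ j - r $ i))"

definition planar_noncollinear_central :: "real ^ 'n \<Rightarrow> (real ^ 2 ^ 'n::finite) set" where
  "planar_noncollinear_central m =
     {r. \<not> collinear (range (\<lambda>i. r $ i)) \<and> (\<exists>\<xi>. \<xi> \<noteq> 0 \<and> central_with_multiplier m r \<xi>)}"


section \<open>Similarities\<close>

definition is_similarity :: "('a::euclidean_space \<Rightarrow> 'a) \<Rightarrow> bool" where
  "is_similarity f \<longleftrightarrow>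
     (\<exists>a c A. c \<noteq> 0 \<and> orthogonal_transformation A \<and> f = (\<lambda>v. a + c *\<^sub>R A v))"

definition same_up_to_similarity ::
  "(('a::euclidean_space ^ 'n::finite) \<times> ('a ^ 'n)) set" where
  "same_up_to_similarity = {(r, r'). \<exists>f. is_similarity f \<and> (\<forall>i. f (r $ i) = r' $ i)}"

text \<open>In the plane, the reflection in the line through \<open>c\<close> orthogonal to \<open>n \<noteq> 0\<close>.\<close>

definition mirror :: "real ^ 2 \<Rightarrow> real ^ 2 \<Rightarrow> real ^ 2 \<Rightarrow> real ^ 2" where
  "mirror c n v = v - (2 * ((v - c) \<bullet> n) / (n \<bullet> n)) *\<^sub>R n"

text \<open>
  The mirror image of a configuration in the line through \<open>c\<close> orthogonal to the base
  \<open>[r\<^sub>1, r\<^sub>2]\<close>, followed by the exchange of bodies 1 and 2 and of bodies 3 and 4.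
\<close>

definition mirror_exchange :: "real ^ 2 \<Rightarrow> real ^ 2 ^ 4 \<Rightarrow> real ^ 2 ^ 4" where
  "mirror_exchange c r =
     (let \<sigma> = mirror c (r $ 2 - r $ 1)
      in vector [\<sigma> (r $ 2), \<sigma> (r $ 1), \<sigma> (r $ 4), \<sigma> (r $ 3)])"


section \<open>Trapezoids\<close>

text \<open>
  The trapezoid with bases \<open>[a, b]\<close> and \<open>[c, d]\<close>. The two bases need not have the same
  direction: the legs are \<open>[b, c]\<close>, \<open>[d, a]\<close> or \<open>[a, c]\<close>, \<open>[b, d]\<close>, whichever pair does not cross.
\<close>

definition trapezoid :: "real ^ 2 \<Rightarrow> real ^ 2 \<Rightarrow> real ^ 2 \<Rightarrow> real ^ 2 \<Rightarrow> bool" where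
  "trapezoid a b c d \<longleftrightarrow>
     a \<noteq> b \<and> c \<noteq> d \<and> \<not> collinear {a, b, c, d} \<and>
     affine_parallel (affine hull {a, b}) (affine hull {c, d})"

definition band :: "real ^ 2 \<Rightarrow> real ^ 2 \<Rightarrow> (real ^ 2) set" where
  "band a b = {r + u | r u. r \<in> closed_segment a b \<and> orthogonal u (b - a)}"

definition balanced :: "real ^ 2 \<Rightarrow> real ^ 2 \<Rightarrow> real ^ 2 \<Rightarrow> real ^ 2 \<Rightarrow> bool" where
  "balanced a b c d \<longleftrightarrow> band a b \<subseteq> band c d \<or> band c d \<subseteq> band a b"

definition unbalanced :: "real ^ 2 \<Rightarrow> real ^ 2 \<Rightarrow> real ^ 2 \<Rightarrow> real ^ 2 \<Rightarrow> bool" where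
  "unbalanced a b c d \<longleftrightarrow> band a b \<inter> band c d = {}"

definition semi_balanced :: "real ^ 2 \<Rightarrow> real ^ 2 \<Rightarrow> real ^ 2 \<Rightarrow> real ^ 2 \<Rightarrow> bool" where
  "semi_balanced a b c d \<longleftrightarrow> \<not> balanced a b c d \<and> \<not> unbalanced a b c d"

text \<open>The vertices of a rhombus are listed in cyclic order: it is an equilateral parallelogram.\<close>

definition rhombus :: "real ^ 2 \<Rightarrow> real ^ 2 \<Rightarrow> real ^ 2 \<Rightarrow> real ^ 2 \<Rightarrow> bool" where
  "rhombus a b c d \<longleftrightarrow>
     \<not> collinear {a, b, c} \<and> b - a = c - d \<and>
     dist a b = dist b c \<and> dist b c = dist c d \<and> dist c d = dist d a"

text \<open>
  Four points in convex position can be split into two segments that meet in exactly one way;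
  these segments are the diagonals. The set equation forces the four indices to be distinct.
\<close>

definition on_same_diagonal :: "real ^ 2 ^ 4 \<Rightarrow> 4 \<Rightarrow> 4 \<Rightarrow> bool" where
  "on_same_diagonal r i j \<longleftrightarrow>
     (\<exists>k l. {i, j, k, l} = UNIV \<and>
        closed_segment (r $ i) (r $ j) \<inter> closed_segment (r $ k) (r $ l) \<noteq> {})"

end

theory Submission
  imports Defs
begin

text \<open>
  Write \<open>S\<^sub>i\<^sub>j\<close> for the inverse cube of the distance between the bodies \<open>i\<close> and \<open>j\<close>. The total mass
  \<open>x - x + y - y\<close> vanishes, so that summing the equations of a central configuration with the
  masses as weights leaves \<open>\<xi> (x (r\<^sub>1 - r\<^sub>2) + y (r\<^sub>3 - r\<^sub>4)) = 0\<close> (\<open>zero_mass_moment\<close>). As \<open>\<xi> \<noteq> 0\<close>, the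
  segments \<open>[r\<^sub>1, r\<^sub>2]\<close> and \<open>[r\<^sub>3, r\<^sub>4]\<close> are parallel: \<open>r\<^sub>4 - r\<^sub>3 = l (r\<^sub>2 - r\<^sub>1)\<close> with \<open>l = - x / y\<close>. This already
  settles which base is the shorter one. Resolved along the base and transversally to it, the
  remaining equations say exactly that
  \<open>S\<^sub>1\<^sub>2 + S\<^sub>3\<^sub>4 = S\<^sub>1\<^sub>3 + S\<^sub>2\<^sub>4 = S\<^sub>1\<^sub>4 + S\<^sub>2\<^sub>3\<close>, and they determine \<open>\<xi>\<close> (\<open>central_iff_weights\<close>).

  Up to similarity such a trapezoid is given by the displacement of the midpoint of one base from
  the midpoint of the other, measured with \<open>[r\<^sub>1, r\<^sub>2]\<close> as unit of length: its component \<open>t\<close> along the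
  base and the square \<open>q\<close> of its height (\<open>similar_if_same_shape\<close>). The squared lengths of the sides
  and diagonals are then \<open>(t \<plusminus> c)\<^sup>2 + q\<close>, where \<open>c\<close> is half the sum or half the difference of \<open>1\<close> and \<open>l\<close>, and
  those of the bases are \<open>1\<close> and \<open>l\<^sup>2\<close>. This gives two equations for the two unknowns \<open>t\<close> and \<open>q\<close>, both of
  them even in \<open>t\<close>. The heart of the proof is that they have exactly one solution with \<open>t > 0\<close>: the
  first equation describes a curve, explicitly parametrised by the value of one of its two summands,
  and the left-hand side of the second equation is strictly decreasing along the part of this curve
  that can contain solutions (\<open>H_deriv_neg\<close>). Inequalities satisfied by the solutions give
  semi-balance. The two configurations differ by the sign of \<open>t\<close>, which is what the mirror image
  followed by the exchange of the endpoints of each base reverses.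
\<close>

section \<open>Sums of two inverse cubes\<close>

text \<open>
  The inverse cube of a distance, as a function of the squared distance.
\<close>

definition attraction :: "real \<Rightarrow> real" where "attraction z = z powr (-3/2)"

text \<open>
  Two segments between parallel lines at distance \<open>\<surd>q\<close>, with horizontal components \<open>t + c\<close> and \<open>t - c\<close>:
  this is what the two legs, or the two diagonals, of a trapezoid contribute.
\<close>

definition pair_sum :: "real \<Rightarrow> real \<Rightarrow> real \<Rightarrow> real" where
  "pair_sum c t q = attraction ((t + c)^2 + q) + attraction ((t - c)^2 + q)"

lemma attraction_less: "0 < a \<Longrightarrow> a < b \<Longrightarrow> attraction b < attraction a"
  unfolding attraction_def by (rule powr_less_mono2_neg) auto

lemma attraction_pos: "0 < a \<Longrightarrow> 0 < attraction a"
  unfolding attraction_def by simp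

lemma attraction_less_iff: "0 < a \<Longrightarrow> 0 < b \<Longrightarrow> attraction b < attraction a \<longleftrightarrow> a < b"
  using attraction_less[of a b] attraction_less[of b a] by (cases a b rule: linorder_cases) auto

lemma attraction_inverse: "0 < z \<Longrightarrow> attraction z powr (- (2/3)) = z"
  unfolding attraction_def by (simp add: powr_powr)

lemma attraction_of_powr: "0 < p \<Longrightarrow> attraction (p powr (- (2/3))) = p"
  unfolding attraction_def by (simp add: powr_powr)

lemma attraction_deriv: assumes "(g has_real_derivative g') (at p)" "0 < g p"
  shows "((\<lambda>p. attraction (g p)) has_real_derivative (- (3/2) * g p powr (-5/2) * g')) (at p)"
proof -
  have "(-3/2 :: real) - 1 = -5/2" by simp
  with DERIV_chain2[OF has_real_derivative_powr[OF assms(2), of "-3/2"] assms(1)]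
  show ?thesis unfolding attraction_def by simp
qed

lemma pair_sum_minus_t: "pair_sum c (-t) q = pair_sum c t q"
  unfolding pair_sum_def by (simp add: power2_eq_square algebra_simps)

lemma pair_sum_abs_t: "pair_sum c \<bar>t\<bar> q = pair_sum c t q"
  by (simp add: abs_if pair_sum_minus_t)

lemma pair_sum_abs_c: "pair_sum \<bar>c\<bar> t q = pair_sum c t q"
  by (simp add: abs_if pair_sum_def)

section \<open>The two equations for the shape\<close>

text \<open>
  The sum and the difference of \<open>S\<close> and \<open>D\<close> are the lengths of the two bases, the longer one first. The equations to be
  solved are \<open>pair_sum S t q = K\<close> (the diagonals) and \<open>pair_sum D t q = K\<close> (the legs).

  The curve of the first equation is parametrised by the contribution \<open>p\<close> of the shorter diagonal.
  The squares of the shorter and of the longer diagonal are then \<open>Bm p\<close> and \<open>Bp p\<close>. Their difference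
  yields \<open>T p\<close>, the value of \<open>t\<close>, and their mean yields \<open>Q p\<close>, the value of \<open>t\<^sup>2 + q\<close>. Finally \<open>Am p\<close> and \<open>Ap p\<close>
  are the squares of the legs, and \<open>H p\<close> is the left-hand side of the second equation.
\<close>

locale trapezoid_equations =
  fixes S D :: real
  assumes D0: "0 \<le> D" and DS: "D < S"
begin

definition "K = attraction ((S + D)^2) + attraction ((S - D)^2)"
definition "Bm p = p powr (-2/3)" for p :: real
definition "Bp p = (K - p) powr (-2/3)"
definition "T p = (Bp p - Bm p) / (4 * S)"
definition "Q p = (Bp p + Bm p) / 2 - S^2"
definition "Ap p = Q p + D^2 + 2 * D * T p"
definition "Am p = Q p + D^2 - 2 * D * T p"
definition "H p = attraction (Ap p) + attraction (Am p)"

lemma S0: "0 < S" using D0 DS by simp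
lemma K0: "0 < K" unfolding K_def using D0 DS by (intro add_pos_pos attraction_pos) auto

lemma B_eq: "Bp p = Q p + S^2 + 2 * S * T p" "Bm p = Q p + S^2 - 2 * S * T p"
  unfolding Q_def T_def using S0 by (auto simp: field_simps power2_eq_square)

lemma B_pos: "0 < p \<Longrightarrow> 0 < Bm p" "p < K \<Longrightarrow> 0 < Bp p"
  unfolding Bm_def Bp_def by auto

lemma T_less: assumes "0 < p1" "p1 < p2" "p2 < K" shows "T p1 < T p2"
proof -
  have "Bm p2 < Bm p1" unfolding Bm_def using assms by (intro powr_less_mono2_neg) auto
  moreover have "Bp p1 < Bp p2" unfolding Bp_def using assms by (intro powr_less_mono2_neg) auto
  ultimately show ?thesis unfolding T_def using S0 by (intro divide_strict_right_mono) auto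
qed

lemma T_mono: assumes "0 < p1" "p1 \<le> p2" "p2 < K" shows "T p1 \<le> T p2"
  using T_less[of p1 p2] assms by (cases "p1 = p2") auto

text \<open>
  For \<open>t \<ge> (S + D) / 2\<close> even the shorter leg is at least as long as the shorter diagonal, which keeps
  the inverse cubes defined. The bound \<open>S D < Q\<close> is the one that decides the sign of \<open>H'\<close>.
\<close>

lemma A_pos:
  assumes "0 < p" "(S + D) / 2 \<le> T p" shows "0 < Am p" "Am p \<le> Ap p" "S * D < Q p"
proof -
  have "0 \<le> (S - D) * (2 * T p - S - D)" using assms DS by simp
  then have "Bm p \<le> Am p" unfolding B_eq Am_def by (simp add: algebra_simps power2_eq_square)
  with B_pos(1)[OF assms(1)] show "0 < Am p" by simp
  show "Am p \<le> Ap p" unfolding Ap_def Am_def using assms D0 DS by simp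
  have "S * ((S + D)/2) \<le> S * T p" using assms S0 by (intro mult_left_mono) auto
  with B_pos(1)[OF assms(1)] show "S * D < Q p"
    unfolding B_eq by (simp add: algebra_simps power2_eq_square)
qed

text \<open>
  In terms of the variables \<open>t\<close> and \<open>Q = t\<^sup>2 + q\<close>, the level curves of both left-hand sides have slopes
  \<open>\<ge> 0\<close>. That of \<open>pair_sum c\<close> has slope \<open>2 c (1 - \<rho>) / (1 + \<rho>)\<close>, where \<open>\<rho>\<close> is the power \<open>5/2\<close> of the ratio
  of the smaller to the larger squared length. This ratio is \<open>(1 - \<tau>) / (1 + \<tau>)\<close> for
  \<open>\<tau> = 2 c t / (Q + c\<^sup>2)\<close>, and \<open>\<tau>\<close> is larger for \<open>c = S\<close> than for \<open>c = D\<close> when \<open>Q > S D\<close>. So the curve of the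
  first equation climbs faster than the level curves of the second sum, which decreases with \<open>Q\<close>.
\<close>

lemma H_deriv_neg:
  assumes "0 < p" "p < K" "(S + D) / 2 \<le> T p"
  shows "\<exists>y. (H has_real_derivative y) (at p) \<and> y < 0"
proof -
  define bp bm where "bp = Bp p powr (5/2)" and "bm = Bm p powr (5/2)"
  define ap am where "ap = Ap p powr (5/2)" and "am = Am p powr (5/2)"
  note B = B_pos(1)[OF assms(1)] B_pos(2)[OF assms(2)] and A = A_pos[OF assms(1,3)]
  have T0: "0 < T p" using assms(3) D0 DS by simp
  have dBm: "(Bm has_real_derivative - (2/3) * bm) (at p)"
    unfolding Bm_def[abs_def] bm_def using assms(1)
    by (auto intro!: derivative_eq_intros simp: powr_powr)
  have dBp: "(Bp has_real_derivative (2/3) * bp) (at p)"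
    unfolding Bp_def[abs_def] bp_def using assms(2)
    by (auto intro!: derivative_eq_intros simp: powr_powr)
  \<comment> \<open>\<open>Ap\<close> and \<open>Am\<close> interpolate linearly between \<open>Bp\<close> and \<open>Bm\<close>, with the weights \<open>(1 + k) / 2\<close> and \<open>(1 - k) / 2\<close>.\<close>
  define k where "k = D / S"
  have k: "0 \<le> k" "k < 1" unfolding k_def using D0 DS by auto
  define dp dm where "dp = (1/3) * ((1 + k) * bp - (1 - k) * bm)"
    and "dm = (1/3) * ((1 - k) * bp - (1 + k) * bm)"
  have dAp: "(Ap has_real_derivative dp) (at p)"
    unfolding Ap_def[abs_def] Q_def T_def dp_def k_def using S0
    by (auto intro!: derivative_eq_intros dBm dBp simp: field_simps)
  have dAm: "(Am has_real_derivative dm) (at p)"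
    unfolding Am_def[abs_def] Q_def T_def dm_def k_def using S0
    by (auto intro!: derivative_eq_intros dBm dBp simp: field_simps)
  have "(H has_real_derivative - (3/2) * Ap p powr (-5/2) * dp + - (3/2) * Am p powr (-5/2) * dm) (at p)"
    unfolding H_def[abs_def] using A
    by (intro DERIV_add attraction_deriv dAp dAm) auto
  moreover have "Ap p powr (-5/2) = 1 / ap" "Am p powr (-5/2) = 1 / am"
    unfolding ap_def am_def by (simp_all add: powr_minus_divide)
  moreover have "0 < dp / ap + dm / am"
  proof -
    have pos: "0 < ap" "0 < am" "0 < bp" "0 < bm" unfolding ap_def am_def bp_def bm_def using A B by auto
    have "am \<le> ap" unfolding ap_def am_def using A by (intro powr_mono2) auto
    have "bm < bp" unfolding bp_def bm_def using B S0 T0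
      by (intro powr_less_mono2) (auto simp: B_eq intro: mult_pos_pos)
    \<comment> \<open>The ratio of the squared diagonals is further from \<open>1\<close> than that of the squared legs.\<close>
    have "Am p * Bp p - Ap p * Bm p = 4 * T p * (S - D) * (Q p - S * D)"
      unfolding B_eq Ap_def Am_def by (simp add: algebra_simps power2_eq_square)
    also have "\<dots> \<ge> 0" using T0 DS A by simp
    finally have "Ap p * Bm p \<le> Am p * Bp p" by simp
    then have "(Ap p * Bm p) powr (5/2) \<le> (Am p * Bp p) powr (5/2)"
      using A B by (intro powr_mono2) auto
    then have key: "ap * bm \<le> am * bp" unfolding ap_def am_def bp_def bm_def using A B
      by (simp add: powr_mult)
    have "k * ((ap - am) * (bp + bm)) < (ap + am) * (bp - bm)"
    proof (cases "ap = am")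
      case True
      then show ?thesis using pos \<open>bm < bp\<close> by simp
    next
      case False
      then have "k * ((ap - am) * (bp + bm)) < 1 * ((ap - am) * (bp + bm))"
        using k pos \<open>am \<le> ap\<close> by (intro mult_strict_right_mono) auto
      also have "\<dots> \<le> (ap + am) * (bp - bm)" using key by (simp add: algebra_simps)
      finally show ?thesis .
    qed
    then have "0 < dp * am + dm * ap" unfolding dp_def dm_def by (simp add: algebra_simps)
    then have "0 < (dp * am + dm * ap) / (ap * am)" using pos by simp
    then show ?thesis using pos by (simp add: add_frac_eq mult.commute)
  qed
  ultimately show ?thesis by (intro exI conjI) (assumption, simp)
qed

lemma H_less:
  assumes "0 < p1" "p1 < p2" "p2 < K" "(S + D) / 2 \<le> T p1"
  shows "H p2 < H p1"
proof (rule DERIV_neg_imp_decreasing[OF assms(2)])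
  fix p assume p: "p1 \<le> p" "p \<le> p2"
  then show "\<exists>y. (H has_real_derivative y) (at p) \<and> y < 0"
    using assms T_mono[of p1 p] by (intro H_deriv_neg) auto
qed

definition solution :: "real \<Rightarrow> real \<Rightarrow> bool" where
  "solution t q \<longleftrightarrow> pair_sum S t q = K \<and> pair_sum D t q = K"

text \<open>
  The longer diagonal contributes less than the longer leg, so the shorter diagonal must contribute
  more than the shorter leg; hence it is shorter, which is the first bound. If \<open>t \<ge> S\<close>, both legs would
  be longer than the corresponding bases and their inverse cubes could not add up to \<open>K\<close>.
\<close>

lemma solution_bounds:
  assumes "0 \<le> t" "0 < q" "solution t q"
  shows "(S + D) / 2 < t" "t < S"
proof -
  have q: "0 < c^2 + q" for c using assms(2) by (simp add: add_nonneg_pos)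
  have "(t + D)^2 < (t + S)^2" using assms(1) D0 DS by (intro power_strict_mono) auto
  then have "attraction ((t + S)^2 + q) < attraction ((t + D)^2 + q)" by (intro attraction_less q) auto
  with assms(3) have "attraction ((t - D)^2 + q) < attraction ((t - S)^2 + q)"
    unfolding solution_def pair_sum_def by linarith
  then have "(t - S)^2 < (t - D)^2" by (simp add: attraction_less_iff q)
  then have "0 < (S - D) * (2 * t - S - D)" by (simp add: algebra_simps power2_eq_square)
  then show "(S + D) / 2 < t" using DS by (simp add: zero_less_mult_iff)
  show "t < S"
  proof (rule ccontr)
    assume "\<not> t < S"
    then have "(S + D)^2 \<le> (t + D)^2" "(S - D)^2 \<le> (t - D)^2" using D0 DS by (auto intro!: power_mono)
    then have "attraction ((t + D)^2 + q) < attraction ((S + D)^2)" "attraction ((t - D)^2 + q) < attraction ((S - D)^2)"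
      using D0 DS assms(2) by (auto intro!: attraction_less)
    with assms(3) show False unfolding solution_def pair_sum_def K_def by linarith
  qed
qed

text \<open>
  Every solution is a point of the parametrised curve at which \<open>H\<close> takes the value \<open>K\<close>, so that
  uniqueness is a matter of the monotonicity of \<open>H\<close>.
\<close>

lemma solution_param:
  assumes "0 < q" "solution t q"
  defines "p \<equiv> attraction ((t - S)^2 + q)"
  shows "0 < p" "p < K" "T p = t" "Q p = t^2 + q" "H p = K"
proof -
  have q: "0 < c^2 + q" for c using assms(1) by (simp add: add_nonneg_pos)
  have Kp: "K - p = attraction ((t + S)^2 + q)" using assms(2) unfolding solution_def p_def pair_sum_def by linarith
  show "0 < p" unfolding p_def by (intro attraction_pos q)
  have "0 < K - p" unfolding Kp by (intro attraction_pos q)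
  then show "p < K" by simp
  have B: "Bm p = (t - S)^2 + q" "Bp p = (t + S)^2 + q" unfolding Bm_def Bp_def Kp
    using attraction_inverse[OF q[of "t - S"]] attraction_inverse[OF q[of "t + S"]] by (auto simp: p_def)
  show T: "T p = t" unfolding T_def B using S0 by (simp add: field_simps power2_eq_square)
  show Q: "Q p = t^2 + q" unfolding Q_def B by (simp add: field_simps power2_eq_square)
  have "Ap p = (t + D)^2 + q" "Am p = (t - D)^2 + q" unfolding Ap_def Am_def T Q
    by (simp_all add: algebra_simps power2_eq_square)
  then show "H p = K" using assms(2) unfolding H_def solution_def pair_sum_def by simp
qed

lemma solution_unique:
  assumes "0 \<le> t1" "0 < q1" "solution t1 q1" "0 \<le> t2" "0 < q2" "solution t2 q2"
  shows "t1 = t2" "q1 = q2"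
proof -
  define p1 p2 where "p1 = attraction ((t1 - S)^2 + q1)" and "p2 = attraction ((t2 - S)^2 + q2)"
  note 1 = solution_param[OF assms(2,3), folded p1_def] and 2 = solution_param[OF assms(5,6), folded p2_def]
  have "p1 = p2"
    using H_less[of p1 p2] H_less[of p2 p1] 1 2 solution_bounds(1)[OF assms(1-3)] solution_bounds(1)[OF assms(4-6)]
    by (cases p1 p2 rule: linorder_cases) auto
  with 1 2 show "t1 = t2" by auto
  with 1 2 \<open>p1 = p2\<close> show "q1 = q2" by auto
qed

lemma T_cont: "a \<in> {0<..} \<Longrightarrow> b < K \<Longrightarrow> continuous_on {a..b} T"
  unfolding T_def[abs_def] Bm_def Bp_def using S0 by (intro continuous_intros) auto

text \<open>
  Intermediate value theorem along the curve, between the points with \<open>t = (S + D) / 2\<close> and \<open>t = S\<close>. At the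
  first one the shorter leg and the shorter diagonal are equal while the longer leg is shorter than the longer
  diagonal, so \<open>H > K\<close>. At the second one both legs are longer than the bases, so \<open>H < K\<close>.
\<close>

lemma solution_exists: "\<exists>t q. 0 < t \<and> 0 < q \<and> solution t q"
proof -
  have T0: "T (K/2) = 0" unfolding T_def Bm_def Bp_def by simp
  \<comment> \<open>The parameter \<open>b\<close> makes the square of the longer diagonal exceed that of the shorter one by
    at least \<open>4 S\<^sup>2\<close>, that is, \<open>T b \<ge> S\<close>.\<close>
  define b where "b = K - attraction (4 * S^2 + Bm (K/2))"
  have Bh: "0 < Bm (K/2)" using K0 by (intro B_pos) auto
  have "attraction (4 * S^2 + Bm (K/2)) < attraction (Bm (K/2))" using Bh S0 by (intro attraction_less) auto
  also have "\<dots> = K/2" unfolding Bm_def using K0 by (simp add: attraction_of_powr)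
  finally have b1: "K/2 < b" unfolding b_def by simp
  have b2: "b < K" unfolding b_def using Bh by (simp add: attraction_pos add_nonneg_pos)
  have "Bm b \<le> Bm (K/2)" unfolding Bm_def using b1 K0 by (intro powr_mono2') auto
  moreover have "Bp b = 4 * S^2 + Bm (K/2)" unfolding Bp_def b_def
    using Bh by (simp add: attraction_inverse add_nonneg_pos)
  ultimately have "S \<le> T b" unfolding T_def using S0 by (simp add: field_simps power2_eq_square)
  then obtain p1 where p1: "K/2 \<le> p1" "p1 \<le> b" "T p1 = S"
    using IVT'[of T "K/2" S b] T0 S0 b1 b2 T_cont[of "K/2" b] K0 by auto
  obtain p0 where p0: "K/2 \<le> p0" "p0 \<le> p1" "T p0 = (S + D) / 2"
    using IVT'[of T "K/2" "(S+D)/2" p1] T0 S0 D0 DS p1 b2 T_cont[of "K/2" p1] K0 by auto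
  have range: "0 < p" "p < K" "(S + D) / 2 \<le> T p" if "p0 \<le> p" "p \<le> p1" for p
    using that p0 p1 b2 K0 T_mono[of p0 p] by auto
  have "H p1 < K"
  proof -
    have "Q p1 = Bm p1 + S^2" using p1(3) unfolding B_eq by (simp add: power2_eq_square)
    moreover have "0 < Bm p1" using range p0 by (intro B_pos) auto
    ultimately have "(S + D)^2 < Ap p1" "(S - D)^2 < Am p1" unfolding Ap_def Am_def p1(3)
      by (simp_all add: algebra_simps power2_eq_square)
    then have "attraction (Ap p1) < attraction ((S + D)^2)" "attraction (Am p1) < attraction ((S - D)^2)"
      using D0 DS by (auto intro!: attraction_less)
    then show ?thesis unfolding H_def K_def by simp
  qed
  moreover have "K < H p0"
  proof -
    note r = range[OF order_refl p0(2)]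
    have "Am p0 = Bm p0" unfolding B_eq Am_def p0(3) by (simp add: field_simps power2_eq_square)
    then have "attraction (Am p0) = p0" using r by (simp add: Bm_def attraction_of_powr)
    moreover have "Ap p0 < Bp p0"
    proof -
      have "D^2 < S^2" using D0 DS by (intro power_strict_mono) auto
      moreover have "D * (S+D) < S * (S + D)" using D0 DS by (intro mult_strict_right_mono) auto
      ultimately show ?thesis unfolding B_eq Ap_def p0(3) by simp
    qed
    then have "attraction (Bp p0) < attraction (Ap p0)" using A_pos[OF r(1,3)] by (intro attraction_less) auto
    moreover have "attraction (Bp p0) = K - p0" unfolding Bp_def using r by (simp add: attraction_of_powr)
    ultimately show ?thesis unfolding H_def by simp
  qed
  moreover have "continuous_on {p0..p1} H"
    using H_deriv_neg range DERIV_isCont by (meson atLeastAtMost_iff continuous_at_imp_continuous_on)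
  ultimately obtain p where p: "p0 \<le> p" "p \<le> p1" "H p = K"
    using IVT2'[of H p1 K p0] p0(2) by auto
  note r = range[OF p(1,2)] note A = A_pos[OF r(1,3)]
  have "p < p1" using p \<open>H p1 < K\<close> by (cases "p = p1") auto
  then have TS: "T p < S" using T_less[of p p1] r range[of p1] p0 p1 by auto
  define q where "q = Q p - (T p)^2"
  have Aq: "Ap p = (T p + D)^2 + q" "Am p = (T p - D)^2 + q" "Bp p = (T p + S)^2 + q" "Bm p = (T p - S)^2 + q"
    unfolding B_eq Ap_def Am_def q_def by (simp_all add: algebra_simps power2_eq_square)
  \<comment> \<open>With \<open>q \<le> 0\<close> the legs would be shorter than the bases.\<close>
  have "0 < q"
  proof (rule ccontr)
    assume "\<not> 0 < q"
    moreover have "(T p + D)^2 < (S + D)^2" "(T p - D)^2 < (S - D)^2"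
      using TS r D0 DS by (auto intro!: power_strict_mono)
    ultimately have "Ap p < (S + D)^2" "Am p < (S - D)^2" unfolding Aq by linarith+
    then have "attraction ((S + D)^2) < attraction (Ap p)" "attraction ((S - D)^2) < attraction (Am p)"
      using A by (auto intro!: attraction_less)
    with p(3) show False unfolding H_def K_def by simp
  qed
  moreover have "solution (T p) q"
    using p(3) r unfolding solution_def pair_sum_def Aq[symmetric] H_def
    by (simp add: Bp_def Bm_def attraction_of_powr)
  ultimately show ?thesis using r D0 DS by (intro exI[of _ "T p"] exI[of _ q]) auto
qed

end

text \<open>
  The two equations when the bases have lengths \<open>1\<close> and \<open>\<bar>l\<bar>\<close>. The sign of \<open>l\<close> tells whether the bases point
  in the same direction; reversing it exchanges the legs and the diagonals.
\<close>

definition admissible :: "real \<Rightarrow> real \<Rightarrow> real \<Rightarrow> bool" where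
  "admissible l t q \<longleftrightarrow> pair_sum ((1 + l) / 2) t q = attraction 1 + attraction (l^2) \<and>
     pair_sum ((1 - l) / 2) t q = attraction 1 + attraction (l^2)"

lemma admissible_unique_solution:
  assumes "l \<noteq> 0"
  shows "\<exists>t\<^sub>0 q\<^sub>0. 0 < t\<^sub>0 \<and> 0 < q\<^sub>0 \<and> 1 < 2 * t\<^sub>0 \<and> \<bar>l\<bar> < 2 * t\<^sub>0 \<and> 2 * t\<^sub>0 < 1 + \<bar>l\<bar> \<and>
    (\<forall>t q. 0 < q \<longrightarrow> (admissible l t q \<longleftrightarrow> \<bar>t\<bar> = t\<^sub>0 \<and> q = q\<^sub>0))"
proof -
  define S D where "S = (1 + \<bar>l\<bar>) / 2" and "D = \<bar>(1 - \<bar>l\<bar>) / 2\<bar>"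
  have "0 < \<bar>l\<bar>" using assms by simp
  then interpret trapezoid_equations S D by unfold_locales (simp_all add: S_def D_def abs_less_iff)
  have max: "S + D = max 1 \<bar>l\<bar>" and min: "S - D = min 1 \<bar>l\<bar>"
    unfolding S_def D_def by (cases "\<bar>l\<bar> \<le> 1"; simp add: max_def min_def abs_of_nonneg abs_of_nonpos field_simps)+
  have K: "K = attraction 1 + attraction (l^2)" unfolding K_def max min by (auto simp: max_def min_def)
  have SD: "pair_sum S t q = pair_sum ((1 + \<bar>l\<bar>) / 2) t q" "pair_sum D t q = pair_sum ((1 - \<bar>l\<bar>) / 2) t q" for t q
    unfolding D_def pair_sum_abs_c by (simp_all add: S_def)
  have iff: "admissible l t q \<longleftrightarrow> solution \<bar>t\<bar> q" for t q
    unfolding admissible_def solution_def K pair_sum_abs_t SD by (auto simp: abs_if)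
  obtain t\<^sub>0 q\<^sub>0 where sol: "0 < t\<^sub>0" "0 < q\<^sub>0" "solution t\<^sub>0 q\<^sub>0" using solution_exists by blast
  show ?thesis
  proof (intro exI conjI allI impI)
    show "1 < 2 * t\<^sub>0" "\<bar>l\<bar> < 2 * t\<^sub>0" "2 * t\<^sub>0 < 1 + \<bar>l\<bar>"
      using solution_bounds[OF less_imp_le[OF sol(1)] sol(2,3)] unfolding max by (auto simp: S_def)
    show "admissible l t q \<longleftrightarrow> \<bar>t\<bar> = t\<^sub>0 \<and> q = q\<^sub>0" if "0 < q" for t q
      using solution_unique[of "\<bar>t\<bar>" q t\<^sub>0 q\<^sub>0] that sol unfolding iff by auto
  qed (use sol in auto)
qed

text \<open>
  Up to a factor, this expression is the multiplier. Its two terms have the same sign because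
  \<open>\<bar>t\<bar>\<close> exceeds half the length of either base.
\<close>

lemma multiplier_nonzero:
  assumes "l \<noteq> 0" "0 < q" "1 < 2 * \<bar>t\<bar>" "\<bar>l\<bar> < 2 * \<bar>t\<bar>"
  defines "a13 \<equiv> attraction ((t + (1 - l) / 2)^2 + q)"
    and "a14 \<equiv> attraction ((t + (1 + l) / 2)^2 + q)" and "a23 \<equiv> attraction ((t - (1 + l) / 2)^2 + q)"
  shows "(a14 - a13) - l * (a23 - a13) \<noteq> 0"
proof -
  have q: "0 < c^2 + q" for c using assms(2) by (simp add: add_nonneg_pos)
  have e: "(t + (1 + l) / 2)^2 - (t + (1 - l) / 2)^2 = l * (2 * t + 1)"
    "(t + (1 - l) / 2)^2 - (t - (1 + l) / 2)^2 = 2 * t - l"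
    by (simp_all add: field_simps power2_eq_square)
  have i: "a14 < a13 \<longleftrightarrow> 0 < l * (2 * t + 1)" "a13 < a14 \<longleftrightarrow> l * (2 * t + 1) < 0"
    "a13 < a23 \<longleftrightarrow> 0 < 2 * t - l" "a23 < a13 \<longleftrightarrow> 2 * t - l < 0"
    unfolding a13_def a14_def a23_def attraction_less_iff[OF q q] e[symmetric] by auto
  consider "0 < t" "0 < l" | "0 < t" "l < 0" | "t < 0" "0 < l" | "t < 0" "l < 0"
    using assms(1,3) by fastforce
  then show ?thesis
  proof cases
    case 1
    then have "a14 < a13" "0 < l * (a23 - a13)" using assms(3,4) by (auto simp: i)
    then show ?thesis by simp
  next
    case 2
    then have "a13 < a14" "l * (a23 - a13) < 0" using assms(3,4) by (auto simp: i mult_less_0_iff)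
    then show ?thesis by simp
  next
    case 3
    then have "a13 < a14" "l * (a23 - a13) < 0" using assms(3,4) by (auto simp: i mult_less_0_iff)
    then show ?thesis by simp
  next
    case 4
    then have "a14 < a13" "0 < l * (a23 - a13)" using assms(3,4) by (auto simp: i zero_less_mult_iff)
    then show ?thesis by simp
  qed
qed

section \<open>Central configurations with zero total mass\<close>

lemma acceleration_alt:
  "acceleration m r i = (\<Sum>j\<in>UNIV. (m $ j / norm (r $ j - r $ i) ^ 3) *\<^sub>R (r $ j - r $ i))"
  unfolding acceleration_def by (rule sum.mono_neutral_left) auto

text \<open>
  The mutual attractions cancel in pairs.
\<close>

lemma sum_mass_acceleration:
  "(\<Sum>i\<in>UNIV. m $ i *\<^sub>R acceleration m r i) = 0"
proof -
  define F where "F i j = (m $ i * m $ j / norm (r $ j - r $ i) ^ 3) *\<^sub>R (r $ j - r $ i)" for i j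
  have F: "(\<Sum>i\<in>UNIV. m $ i *\<^sub>R acceleration m r i) = (\<Sum>i\<in>UNIV. \<Sum>j\<in>UNIV. F i j)"
    unfolding acceleration_alt F_def scaleR_sum_right by simp
  have antisym: "F j i = - F i j" for i j
    unfolding F_def norm_minus_commute[of "r $ i" "r $ j"] by (simp add: mult.commute algebra_simps)
  define X where "X = (\<Sum>i\<in>UNIV. \<Sum>j\<in>UNIV. F i j)"
  have "X = (\<Sum>i\<in>UNIV. \<Sum>j\<in>UNIV. F j i)" unfolding X_def by (rule sum.swap)
  also have "\<dots> = - X" unfolding X_def sum_negf[symmetric] by (intro sum.cong refl antisym)
  finally have "X + X = 0" by (rule eq_neg_iff_add_eq_0[THEN iffD1])
  then have "2 *\<^sub>R X = 0" unfolding scaleR_2 .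
  then show ?thesis unfolding F X_def[symmetric] by simp
qed

text \<open>
  In the sum of the equations weighted by the masses the accelerations cancel, and so does the arbitrary
  reference body \<open>k\<close>, whose coefficient is the total mass.
\<close>

lemma zero_mass_moment:
  assumes "central_with_multiplier m r \<xi>" "(\<Sum>i\<in>UNIV. m $ i) = 0" "\<xi> \<noteq> 0"
  shows "(\<Sum>i\<in>UNIV. m $ i *\<^sub>R r $ i) = 0"
proof -
  fix k
  define g where "g i = acceleration m r k + \<xi> *\<^sub>R (r $ i - r $ k)" for i
  have "acceleration m r i = g i" for i
  proof -
    have "acceleration m r i - acceleration m r k = \<xi> *\<^sub>R (r $ i - r $ k)"
      using assms(1) unfolding central_with_multiplier_def by blast
    then show ?thesis unfolding g_def by (simp only: diff_eq_eq add.commute)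
  qed
  then have "(\<Sum>i\<in>UNIV. m $ i *\<^sub>R g i) = 0" using sum_mass_acceleration[of m r] by simp
  moreover have "m $ i *\<^sub>R g i =
     m $ i *\<^sub>R (acceleration m r k - \<xi> *\<^sub>R r $ k) + \<xi> *\<^sub>R (m $ i *\<^sub>R r $ i)" for i
    unfolding g_def by (simp add: algebra_simps)
  ultimately have "(\<Sum>i\<in>UNIV. m $ i) *\<^sub>R (acceleration m r k - \<xi> *\<^sub>R r $ k) +
     \<xi> *\<^sub>R (\<Sum>i\<in>UNIV. m $ i *\<^sub>R r $ i) = 0"
    by (simp only: sum.distrib scaleR_sum_left scaleR_sum_right)
  then show ?thesis using assms(2,3) by simp
qed

section \<open>Shape of a quadrilateral with parallel bases\<close>

text \<open>
  The vector \<open>midline r\<close> joins the midpoint of \<open>[r\<^sub>1, r\<^sub>2]\<close> to that of \<open>[r\<^sub>3, r\<^sub>4]\<close>. Referring the shape to the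
  midpoints makes \<open>shift\<close> change its sign under the mirror image with exchange.
\<close>

definition base :: "'a::real_inner ^ 4 \<Rightarrow> 'a" where "base r = r $ 2 - r $ 1"
definition midline :: "'a::real_inner ^ 4 \<Rightarrow> 'a" where
  "midline r = (1/2) *\<^sub>R (r $ 3 + r $ 4 - r $ 1 - r $ 2)"

definition shift :: "'a::real_inner ^ 4 \<Rightarrow> real" where
  "shift r = (midline r \<bullet> base r) / (base r \<bullet> base r)"

text \<open>
  For parallel bases, the square of the distance between the lines that carry them, with the first
  base as unit of length; it vanishes exactly when these lines coincide.
\<close>

definition height_sq :: "'a::real_inner ^ 4 \<Rightarrow> real" where
  "height_sq r = (midline r \<bullet> midline r) / (base r \<bullet> base r) - (shift r)^2"

definition parallel_bases :: "real \<Rightarrow> 'a::real_inner ^ 4 \<Rightarrow> bool" where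
  "parallel_bases l r \<longleftrightarrow> base r \<noteq> 0 \<and> r $ 4 - r $ 3 = l *\<^sub>R base r \<and> 0 < height_sq r"

lemma norm_combination:
  assumes "base r \<noteq> 0"
  shows "(norm (a *\<^sub>R base r + b *\<^sub>R midline r))^2 = (norm (base r))^2 * ((a + b * shift r)^2 + b^2 * height_sq r)"
proof -
  have u: "base r \<bullet> base r \<noteq> 0" using assms by simp
  have "(norm (a *\<^sub>R base r + b *\<^sub>R midline r))^2 =
    a^2 * (base r \<bullet> base r) + 2 * a * b * (midline r \<bullet> base r) + b^2 * (midline r \<bullet> midline r)"
    unfolding power2_norm_eq_inner by (simp add: inner_simps inner_commute power2_eq_square algebra_simps)
  also have "\<dots> = (base r \<bullet> base r) * ((a + b * shift r)^2 + b^2 * height_sq r)"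
    unfolding height_sq_def shift_def using u by (simp add: field_simps power2_eq_square)
  finally show ?thesis by (simp add: power2_norm_eq_inner)
qed

lemma combination_eq_iff:
  assumes "base r \<noteq> 0" "0 < height_sq r"
  shows "a *\<^sub>R base r + b *\<^sub>R midline r = a' *\<^sub>R base r + b' *\<^sub>R midline r \<longleftrightarrow> a = a' \<and> b = b'"
proof
  assume "a *\<^sub>R base r + b *\<^sub>R midline r = a' *\<^sub>R base r + b' *\<^sub>R midline r"
  then have "(a - a') *\<^sub>R base r + (b - b') *\<^sub>R midline r = 0" by (simp add: algebra_simps)
  with norm_combination[OF assms(1), of "a - a'" "b - b'"] assms(1)
  have z: "((a - a') + (b - b') * shift r)^2 + (b - b')^2 * height_sq r = 0" by simp
  then have "(b - b')^2 * height_sq r = 0"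
    using assms(2) by (smt (verit) mult_nonneg_nonneg zero_le_power2)
  then have "b = b'" using assms(2) by simp
  with z show "a = a' \<and> b = b'" by simp
qed auto

lemma height_sq_nonneg: "0 \<le> height_sq r"
proof (cases "base r = 0")
  case True then show ?thesis by (simp add: height_sq_def shift_def)
next
  case False
  have "(norm (- shift r *\<^sub>R base r + 1 *\<^sub>R midline r))^2 = (norm (base r))^2 * height_sq r"
    unfolding norm_combination[OF False] by simp
  then have "0 \<le> (norm (base r))^2 * height_sq r" by (metis zero_le_power2)
  then show ?thesis using False by (simp add: zero_le_mult_iff)
qed

lemma parallel_bases_nondegenerate:
  assumes "parallel_bases l r"
  shows "base r \<noteq> 0" "0 < height_sq r"
  using assms by (auto simp: parallel_bases_def)

lemma parallel_bases_differences:
  assumes "parallel_bases l r"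
  shows "r $ 2 - r $ 1 = 1 *\<^sub>R base r + 0 *\<^sub>R midline r"
    "r $ 4 - r $ 3 = l *\<^sub>R base r + 0 *\<^sub>R midline r"
    "r $ 3 - r $ 1 = ((1 - l) / 2) *\<^sub>R base r + 1 *\<^sub>R midline r"
    "r $ 4 - r $ 1 = ((1 + l) / 2) *\<^sub>R base r + 1 *\<^sub>R midline r"
    "r $ 3 - r $ 2 = (- (1 + l) / 2) *\<^sub>R base r + 1 *\<^sub>R midline r"
    "r $ 4 - r $ 2 = (- (1 - l) / 2) *\<^sub>R base r + 1 *\<^sub>R midline r"
proof -
  have r: "r $ 2 = r $ 1 + base r" "r $ 4 = r $ 3 + l *\<^sub>R base r"
    using assms unfolding parallel_bases_def by (simp_all add: base_def algebra_simps)
  have m: "midline r = r $ 3 - r $ 1 - ((1 - l) / 2) *\<^sub>R base r"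
  proof -
    have "2 *\<^sub>R midline r = (r $ 3 - r $ 1) + (r $ 3 - r $ 1) + (l - 1) *\<^sub>R base r"
      unfolding midline_def r by (simp add: algebra_simps)
    also have "l - 1 = - (2 * ((1 - l) / 2))" by (simp add: field_simps)
    also have "\<dots> *\<^sub>R base r = - (2 *\<^sub>R (((1 - l) / 2) *\<^sub>R base r))"
      by (simp only: scaleR_scaleR scaleR_minus_left)
    finally have "2 *\<^sub>R midline r = 2 *\<^sub>R (r $ 3 - r $ 1 - ((1 - l) / 2) *\<^sub>R base r)"
      unfolding scaleR_diff_right[of 2 "r $ 3 - r $ 1"] scaleR_2[of "r $ 3 - r $ 1"] by simp
    then show ?thesis by (simp only: scaleR_cancel_left) simp
  qed
  show "r $ 2 - r $ 1 = 1 *\<^sub>R base r + 0 *\<^sub>R midline r"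
    "r $ 4 - r $ 3 = l *\<^sub>R base r + 0 *\<^sub>R midline r" by (simp_all add: r)
  show d: "r $ 3 - r $ 1 = ((1 - l) / 2) *\<^sub>R base r + 1 *\<^sub>R midline r" unfolding m by simp
  have "r $ 4 - r $ 1 = l *\<^sub>R base r + (r $ 3 - r $ 1)" by (simp add: r)
  also have "\<dots> = (l + (1 - l) / 2) *\<^sub>R base r + 1 *\<^sub>R midline r" unfolding d by (simp add: scaleR_add_left)
  also have "l + (1 - l) / 2 = (1 + l) / 2" by (simp add: field_simps)
  finally show e: "r $ 4 - r $ 1 = ((1 + l) / 2) *\<^sub>R base r + 1 *\<^sub>R midline r" .
  have "r $ 3 - r $ 2 = (r $ 3 - r $ 1) + (-1) *\<^sub>R base r" by (simp add: r)
  also have "\<dots> = ((1 - l) / 2 + -1) *\<^sub>R base r + 1 *\<^sub>R midline r" unfolding d scaleR_add_left by simp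
  also have "(1 - l) / 2 + -1 = - (1 + l) / 2" by (simp add: field_simps)
  finally show "r $ 3 - r $ 2 = (- (1 + l) / 2) *\<^sub>R base r + 1 *\<^sub>R midline r" .
  have "r $ 4 - r $ 2 = (r $ 4 - r $ 1) + (-1) *\<^sub>R base r" by (simp add: r)
  also have "\<dots> = ((1 + l) / 2 + -1) *\<^sub>R base r + 1 *\<^sub>R midline r" unfolding e scaleR_add_left by simp
  also have "(1 + l) / 2 + -1 = - (1 - l) / 2" by (simp add: field_simps)
  finally show "r $ 4 - r $ 2 = (- (1 - l) / 2) *\<^sub>R base r + 1 *\<^sub>R midline r" .
qed

lemma parallel_bases_distances:
  assumes "parallel_bases l r"
  shows "(norm (r $ 2 - r $ 1))^2 = (norm (base r))^2 * 1"
    "(norm (r $ 4 - r $ 3))^2 = (norm (base r))^2 * l^2"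
    "(norm (r $ 3 - r $ 1))^2 = (norm (base r))^2 * ((shift r + (1 - l) / 2)^2 + height_sq r)"
    "(norm (r $ 4 - r $ 1))^2 = (norm (base r))^2 * ((shift r + (1 + l) / 2)^2 + height_sq r)"
    "(norm (r $ 3 - r $ 2))^2 = (norm (base r))^2 * ((shift r - (1 + l) / 2)^2 + height_sq r)"
    "(norm (r $ 4 - r $ 2))^2 = (norm (base r))^2 * ((shift r - (1 - l) / 2)^2 + height_sq r)"
  unfolding parallel_bases_differences[OF assms] norm_combination[OF parallel_bases_nondegenerate(1)[OF assms]]
  by (simp_all add: field_simps power2_eq_square)

lemma inverse_cube_norm:
  assumes "(norm v)^2 = n^2 * z" "0 < n" "0 < z"
  shows "1 / norm v ^ 3 = attraction z / n ^ 3"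
proof -
  have "norm v = sqrt (n^2 * z)" using assms(1) by (metis norm_ge_zero real_sqrt_unique)
  also have "\<dots> = n * sqrt z" using assms(2) by (simp add: real_sqrt_mult)
  finally have "1 / norm v ^ 3 = 1 / (n ^ 3 * sqrt z ^ 3)" by (simp add: power_mult_distrib)
  also have "sqrt z ^ 3 = z powr (3/2)" using assms(3)
    by (simp add: powr_half_sqrt[symmetric] powr_powr powr_realpow[symmetric])
  finally show ?thesis unfolding attraction_def by (simp add: powr_minus_divide)
qed

lemma collinear_if_height_zero:
  assumes "base r \<noteq> 0" "r $ 4 - r $ 3 = l *\<^sub>R base r" "height_sq r = 0"
  shows "collinear (range (\<lambda>i. r $ i))"
proof -
  have "(norm (- shift r *\<^sub>R base r + 1 *\<^sub>R midline r))^2 = 0"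
    unfolding norm_combination[OF assms(1)] by (simp add: assms(3))
  then have m: "midline r = shift r *\<^sub>R base r" by (simp add: algebra_simps)
  have "\<exists>c. r $ i = r $ 1 + c *\<^sub>R base r" for i
  proof -
    have r2: "r $ 2 = r $ 1 + 1 *\<^sub>R base r" by (simp add: base_def)
    have r4: "r $ 4 = r $ 3 + l *\<^sub>R base r" using assms(2) by (simp add: algebra_simps)
    have "2 *\<^sub>R midline r = 2 *\<^sub>R (r $ 3) + l *\<^sub>R base r - 2 *\<^sub>R (r $ 1) - base r"
      unfolding midline_def r4 r2 by (simp add: scaleR_2)
    then have "2 *\<^sub>R (r $ 3) = 2 *\<^sub>R (r $ 1 + (shift r + (1 - l)/2) *\<^sub>R base r)"
      unfolding m by (simp add: algebra_simps diff_divide_distrib)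
    then have r3: "r $ 3 = r $ 1 + (shift r + (1 - l)/2) *\<^sub>R base r" by simp
    then have "r $ 4 = r $ 1 + ((shift r + (1 - l)/2) + l) *\<^sub>R base r"
      unfolding r4 by (simp add: scaleR_add_left)
    moreover have "r $ 1 = r $ 1 + 0 *\<^sub>R base r" by simp
    ultimately show ?thesis using r2 r3 exhaust_4[of i] by metis
  qed
  then show ?thesis unfolding collinear_alt by auto
qed

lemma noncollinear_base_apex:
  assumes "parallel_bases l r" "k = 3 \<or> k = 4"
  shows "\<not> collinear {r $ 1, r $ 2, r $ k}"
proof
  assume "collinear {r $ 1, r $ 2, r $ k}"
  then obtain v a b where ab: "r $ 2 - r $ 1 = a *\<^sub>R v" "r $ k - r $ 1 = b *\<^sub>R v"
    unfolding collinear_def by blast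
  have u: "base r \<noteq> 0" "0 < height_sq r" using assms by (auto simp: parallel_bases_def)
  obtain e where e: "r $ k - r $ 1 = e *\<^sub>R base r + 1 *\<^sub>R midline r"
    using assms(2) parallel_bases_differences(3,4)[OF assms(1)] by metis
  have "b *\<^sub>R (r $ 2 - r $ 1) = a *\<^sub>R (r $ k - r $ 1)" unfolding ab by simp
  then have "b *\<^sub>R base r + 0 *\<^sub>R midline r = (a * e) *\<^sub>R base r + a *\<^sub>R midline r"
    unfolding parallel_bases_differences[OF assms(1)] e by (simp add: algebra_simps)
  then have "a = 0" unfolding combination_eq_iff[OF u] by simp
  with ab u show False by (simp add: base_def)
qed

lemma noncollinear_if_parallel_bases:
  assumes "parallel_bases l r"
  shows "\<not> collinear (range (\<lambda>i. r $ i))"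
  using noncollinear_base_apex[OF assms, of 3] collinear_subset[of "range (\<lambda>i. r $ i)" "{r $ 1, r $ 2, r $ 3}"] by auto

lemma parallel_bases_inj:
  assumes "parallel_bases l r" "l \<noteq> 0"
  shows "inj (\<lambda>i. r $ i)"
proof -
  have u: "base r \<noteq> 0" "0 < height_sq r" using assms by (auto simp: parallel_bases_def)
  have z: "a *\<^sub>R base r + b *\<^sub>R midline r \<noteq> 0" if "a \<noteq> 0 \<or> b \<noteq> 0" for a b
    using combination_eq_iff[OF u, of a b 0 0] that by auto
  have "r $ 2 - r $ 1 \<noteq> 0" "r $ 4 - r $ 3 \<noteq> 0" "r $ 3 - r $ 1 \<noteq> 0"
    "r $ 4 - r $ 1 \<noteq> 0" "r $ 3 - r $ 2 \<noteq> 0" "r $ 4 - r $ 2 \<noteq> 0"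
    unfolding parallel_bases_differences[OF assms(1)] by (intro z; use assms(2) in simp)+
  then have "r $ i = r $ j \<longrightarrow> i = j" for i j
    using exhaust_4[of i] exhaust_4[of j] by auto
  then show ?thesis by (auto intro: injI)
qed

text \<open>
  The accelerations are expanded in the independent vectors \<open>base r\<close> and \<open>midline r\<close>. The transversal components give the
  equality of the sums over legs and diagonals and the value of \<open>\<xi>\<close>; the components along the base then
  reduce to the equality with the sum over the bases.
\<close>

lemma central_iff_weights:
  fixes r :: "'a::euclidean_space ^ 4"
  assumes pb: "parallel_bases l r" and l: "l \<noteq> 0" and y: "y \<noteq> 0" and x: "x = - l * y"
  defines "W \<equiv> \<lambda>i j. 1 / norm (r $ j - r $ i) ^ 3"
  shows "central_with_multiplier (vector [x, -x, y, -y]) r \<xi> \<longleftrightarrow>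
    W 1 3 + W 2 4 = W 1 4 + W 2 3 \<and> W 1 2 + W 3 4 = W 1 4 + W 2 3 \<and>
    \<xi> = x * (W 2 3 - W 1 3) + y * (W 1 4 - W 1 3)"
proof -
  define u w where "u = base r" and "w = midline r"
  define m :: "real^4" where "m = vector [x, -x, y, -y]"
  define E F A B C D where "E = W 1 2" and "F = W 3 4" and "A = W 1 3" and "B = W 2 4" and "C = W 1 4" and "D = W 2 3"
  define s d where "s = (1 + l) / 2" and "d = (1 - l) / 2"
  have sd: "s = 1 - d" "l = 1 - 2 * d" unfolding s_def d_def by (auto simp: field_simps)
  have u0: "base r \<noteq> 0" "0 < height_sq r" using pb by (auto simp: parallel_bases_def)
  note dif = parallel_bases_differences[OF pb, folded u_def w_def, simplified minus_divide_left[symmetric], folded s_def d_def, simplified]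
  have dif': "r $ 1 - r $ 2 = - u" "r $ 3 - r $ 4 = - (l *\<^sub>R u)" "r $ 1 - r $ 3 = - (d *\<^sub>R u + w)"
    "r $ 1 - r $ 4 = - (s *\<^sub>R u + w)" "r $ 2 - r $ 3 = s *\<^sub>R u - w" "r $ 2 - r $ 4 = d *\<^sub>R u - w"
    using dif by (auto simp: algebra_simps)
  have Wsym: "W i j = W j i" for i j unfolding W_def by (simp add: norm_minus_commute)
  have acc: "acceleration m r i = (m $ 1 * W i 1) *\<^sub>R (r $ 1 - r $ i) + (m $ 2 * W i 2) *\<^sub>R (r $ 2 - r $ i)
      + (m $ 3 * W i 3) *\<^sub>R (r $ 3 - r $ i) + (m $ 4 * W i 4) *\<^sub>R (r $ 4 - r $ i)" for i
    unfolding acceleration_alt sum_4 W_def by simp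
  have a1: "acceleration m r 1 = (-x*E + y*A*d - y*C * s) *\<^sub>R u + (y*A - y*C) *\<^sub>R w"
    unfolding acc dif dif' unfolding m_def A_def B_def C_def D_def E_def F_def by (simp add: algebra_simps)
  have a2: "acceleration m r 2 = (-x*E - y*D * s + y*B*d) *\<^sub>R u + (y*D - y*B) *\<^sub>R w"
    unfolding acc dif dif' unfolding m_def A_def B_def C_def D_def E_def F_def by (simp add: algebra_simps Wsym[of 2 1])
  have a3: "acceleration m r 3 = (-y*F*l - x*A*d - x*D * s) *\<^sub>R u + (-x*A + x*D) *\<^sub>R w"
    unfolding acc dif dif' unfolding m_def A_def B_def C_def D_def E_def F_def by (simp add: algebra_simps Wsym[of 3 1] Wsym[of 3 2])
  have a4: "acceleration m r 4 = (-y*F*l - x*C * s - x*B*d) *\<^sub>R u + (-x*C + x*B) *\<^sub>R w"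
    unfolding acc dif dif' unfolding m_def A_def B_def C_def D_def E_def F_def by (simp add: algebra_simps Wsym[of 4 1] Wsym[of 4 2] Wsym[of 4 3])
  note ceq = combination_eq_iff[OF u0, folded u_def w_def]
  have "central_with_multiplier m r \<xi> \<longleftrightarrow> (\<forall>i j. acceleration m r j - acceleration m r i = \<xi> *\<^sub>R (r $ j - r $ i))"
    unfolding central_with_multiplier_def using parallel_bases_inj[OF pb l] by simp
  also have "\<dots> \<longleftrightarrow> (\<forall>j. acceleration m r j = acceleration m r 1 + \<xi> *\<^sub>R (r $ j - r $ 1))"
  proof safe
    fix j assume "\<forall>i j. acceleration m r j - acceleration m r i = \<xi> *\<^sub>R (r $ j - r $ i)"
    then have "acceleration m r j - acceleration m r 1 = \<xi> *\<^sub>R (r $ j - r $ 1)" by blast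
    then show "acceleration m r j = acceleration m r 1 + \<xi> *\<^sub>R (r $ j - r $ 1)" by (simp add: algebra_simps)
  next
    fix i j assume "\<forall>j. acceleration m r j = acceleration m r 1 + \<xi> *\<^sub>R (r $ j - r $ 1)"
    then show "acceleration m r j - acceleration m r i = \<xi> *\<^sub>R (r $ j - r $ i)"
      by (metis (no_types, lifting) add_diff_cancel_left diff_diff_eq2 diff_add_cancel scaleR_right_diff_distrib)
  qed
  also have "\<dots> \<longleftrightarrow> 
     ((-x*E - y*D * s + y*B*d) *\<^sub>R u + (y*D - y*B) *\<^sub>R w = (-x*E + y*A*d - y*C * s + \<xi>) *\<^sub>R u + (y*A - y*C) *\<^sub>R w \<and>
      (-y*F*l - x*A*d - x*D * s) *\<^sub>R u + (-x*A + x*D) *\<^sub>R w = (-x*E + y*A*d - y*C * s + \<xi>*d) *\<^sub>R u + (y*A - y*C + \<xi>) *\<^sub>R w \<and>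
      (-y*F*l - x*C * s - x*B*d) *\<^sub>R u + (-x*C + x*B) *\<^sub>R w = (-x*E + y*A*d - y*C * s + \<xi> * s) *\<^sub>R u + (y*A - y*C + \<xi>) *\<^sub>R w)"
    unfolding forall_4 a1 a2 a3 a4 dif by (simp add: algebra_simps)
  also have "\<dots> \<longleftrightarrow> A + B = C + D \<and> E + F = C + D \<and> \<xi> = x * (D - A) + y * (C - A)"
  proof
    assume "A + B = C + D \<and> E + F = C + D \<and> \<xi> = x * (D - A) + y * (C - A)"
    then have e: "B = C + D - A" "E = C + D - F" "\<xi> = x * (D - A) + y * (C - A)" by auto
    then show "(-x*E - y*D * s + y*B*d) *\<^sub>R u + (y*D - y*B) *\<^sub>R w = (-x*E + y*A*d - y*C * s + \<xi>) *\<^sub>R u + (y*A - y*C) *\<^sub>R w \<and>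
      (-y*F*l - x*A*d - x*D * s) *\<^sub>R u + (-x*A + x*D) *\<^sub>R w = (-x*E + y*A*d - y*C * s + \<xi>*d) *\<^sub>R u + (y*A - y*C + \<xi>) *\<^sub>R w \<and>
      (-y*F*l - x*C * s - x*B*d) *\<^sub>R u + (-x*C + x*B) *\<^sub>R w = (-x*E + y*A*d - y*C * s + \<xi> * s) *\<^sub>R u + (y*A - y*C + \<xi>) *\<^sub>R w"
      unfolding ceq e unfolding x sd by (intro conjI; simp add: algebra_simps)
  next
    assume "(-x*E - y*D * s + y*B*d) *\<^sub>R u + (y*D - y*B) *\<^sub>R w = (-x*E + y*A*d - y*C * s + \<xi>) *\<^sub>R u + (y*A - y*C) *\<^sub>R w \<and>
      (-y*F*l - x*A*d - x*D * s) *\<^sub>R u + (-x*A + x*D) *\<^sub>R w = (-x*E + y*A*d - y*C * s + \<xi>*d) *\<^sub>R u + (y*A - y*C + \<xi>) *\<^sub>R w \<and>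
      (-y*F*l - x*C * s - x*B*d) *\<^sub>R u + (-x*C + x*B) *\<^sub>R w = (-x*E + y*A*d - y*C * s + \<xi> * s) *\<^sub>R u + (y*A - y*C + \<xi>) *\<^sub>R w"
    then have h: "y*D - y*B = y*A - y*C" "-x*A + x*D = y*A - y*C + \<xi>"
      "-y*F*l - x*A*d - x*D * s = -x*E + y*A*d - y*C * s + \<xi>*d" unfolding ceq by auto
    have "y * (A + B) = y * (C + D)" using h(1) by (simp add: algebra_simps)
    then have 1: "A + B = C + D" using y by simp
    have 2: "\<xi> = x * (D - A) + y * (C - A)" using h(2) by (simp add: algebra_simps)
    have "(l * y) * (E + F) = (l * y) * (C + D)" using h(3) unfolding 2 x sd by (simp add: algebra_simps)
    then have "E + F = C + D" using y l by simp
    with 1 2 show "A + B = C + D \<and> E + F = C + D \<and> \<xi> = x * (D - A) + y * (C - A)" by simp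
  qed
  finally show ?thesis unfolding m_def A_def B_def C_def D_def E_def F_def .
qed

text \<open>
  The bounds on the solutions of the equations ensure that the multiplier they determine is not zero.
\<close>

lemma planar_noncollinear_central_iff:
  assumes y: "y \<noteq> 0" and l: "l \<noteq> 0" and x: "x = - l * y"
  shows "r \<in> planar_noncollinear_central (vector [x, -x, y, -y]) \<longleftrightarrow>
    parallel_bases l r \<and> admissible l (shift r) (height_sq r)"
proof -
  define m :: "real^4" where "m = vector [x, -x, y, -y]"
  have pb: "parallel_bases l r" if "central_with_multiplier m r \<xi>" "\<xi> \<noteq> 0" "\<not> collinear (range (\<lambda>i. r $ i))" for \<xi>
  proof -
    have "(\<Sum>i\<in>UNIV. m $ i) = 0" by (simp add: sum_4 m_def)
    then have "(\<Sum>i\<in>UNIV. m $ i *\<^sub>R r $ i) = 0" using zero_mass_moment that by blast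
    then have "y *\<^sub>R (r $ 3 - r $ 4 + l *\<^sub>R (r $ 2 - r $ 1)) = 0"
      by (simp add: sum_4 m_def x algebra_simps)
    then have "r $ 3 - r $ 4 + l *\<^sub>R (r $ 2 - r $ 1) = 0" using y by (simp only: scaleR_eq_0_iff) simp
    then have r4: "r $ 4 - r $ 3 = l *\<^sub>R base r" by (simp add: base_def algebra_simps)
    have "inj (\<lambda>i. r $ i)" using that unfolding central_with_multiplier_def by simp
    then have u: "base r \<noteq> 0" unfolding base_def using injD[of "\<lambda>i. r $ i" 2 1] by auto
    have "height_sq r \<noteq> 0" using collinear_if_height_zero[OF u r4] that by blast
    then show ?thesis using u r4 height_sq_nonneg[of r] by (simp add: parallel_bases_def)
  qed
  have iff: "(\<exists>\<xi>. \<xi> \<noteq> 0 \<and> central_with_multiplier m r \<xi>) \<longleftrightarrow> admissible l (shift r) (height_sq r)"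
    if pb: "parallel_bases l r"
  proof -
    define W where "W = (\<lambda>i j. 1 / norm (r $ j - r $ i) ^ 3)"
    define n q t where "n = norm (base r)" and "q = height_sq r" and "t = shift r"
    have n: "0 < n" and q: "0 < q" using pb unfolding n_def q_def parallel_bases_def by auto
    have q': "0 < c^2 + q" for c using q by (simp add: add_nonneg_pos)
    note dist = parallel_bases_distances[OF pb, folded n_def q_def t_def]
    have W: "W 1 2 = attraction 1 / n ^ 3" "W 3 4 = attraction (l^2) / n ^ 3"
      "W 1 3 = attraction ((t + (1 - l) / 2)^2 + q) / n ^ 3" "W 1 4 = attraction ((t + (1 + l) / 2)^2 + q) / n ^ 3"
      "W 2 3 = attraction ((t - (1 + l) / 2)^2 + q) / n ^ 3" "W 2 4 = attraction ((t - (1 - l) / 2)^2 + q) / n ^ 3"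
      unfolding W_def using l by (intro inverse_cube_norm[OF _ n] dist q'; simp)+
    have adm: "admissible l t q \<longleftrightarrow> W 1 3 + W 2 4 = W 1 4 + W 2 3 \<and> W 1 2 + W 3 4 = W 1 4 + W 2 3"
    proof -
      have cancel: "a / n ^ 3 + b / n ^ 3 = c / n ^ 3 + d / n ^ 3 \<longleftrightarrow> a + b = c + d" for a b c d
        using n by (simp flip: add_divide_distrib)
      show ?thesis unfolding admissible_def pair_sum_def W cancel by auto
    qed
    have xi: "x * (W 2 3 - W 1 3) + y * (W 1 4 - W 1 3) \<noteq> 0" if a: "admissible l t q"
    proof -
      obtain t\<^sub>0 q\<^sub>0 where 0: "1 < 2 * t\<^sub>0" "\<bar>l\<bar> < 2 * t\<^sub>0"
        and adm\<^sub>0: "\<forall>t q. 0 < q \<longrightarrow> (admissible l t q \<longleftrightarrow> \<bar>t\<bar> = t\<^sub>0 \<and> q = q\<^sub>0)"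
        using admissible_unique_solution[OF l] by blast
      have t: "\<bar>t\<bar> = t\<^sub>0" using adm\<^sub>0 q a by blast
      have "1 < 2 * \<bar>t\<bar>" "\<bar>l\<bar> < 2 * \<bar>t\<bar>" using 0(1,2) t by auto
      note nonzero = multiplier_nonzero[OF l q this]
      have "(a / n ^ 3 - b / n ^ 3) - l * (c / n ^ 3 - b / n ^ 3) = ((a - b) - l * (c - b)) / n ^ 3" for a b c
        by (simp add: diff_divide_distrib right_diff_distrib)
      then have "(W 1 4 - W 1 3) - l * (W 2 3 - W 1 3) \<noteq> 0"
        unfolding W using nonzero n by simp
      then have "y * ((W 1 4 - W 1 3) - l * (W 2 3 - W 1 3)) \<noteq> 0" using y by simp
      then show ?thesis unfolding x by (simp add: algebra_simps)
    qed
    have W_fold: "1 / norm (r $ j - r $ i) ^ 3 = W i j" for i j by (simp add: W_def)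
    show ?thesis
      unfolding m_def central_iff_weights[OF pb l y x] W_fold q_def[symmetric] t_def[symmetric] adm
      using xi unfolding adm by blast
  qed
  show ?thesis
    unfolding planar_noncollinear_central_def m_def[symmetric]
    using pb iff noncollinear_if_parallel_bases by blast
qed

section \<open>Similarity classes\<close>

text \<open>
  A similarity multiplies all inner products of differences by the same factor.
\<close>

lemma shift_similar:
  fixes r r' :: "'a::euclidean_space ^ 4"
  assumes "(r, r') \<in> same_up_to_similarity"
  shows "shift r' = shift r"
proof -
  obtain f where "is_similarity f" and f: "\<And>i. f (r $ i) = r' $ i"
    using assms unfolding same_up_to_similarity_def by blast
  then obtain a c A where c: "c \<noteq> 0" and A: "orthogonal_transformation A"
    and f_eq: "f = (\<lambda>v. a + c *\<^sub>R A v)"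
    unfolding is_similarity_def by blast
  interpret A: linear A using A by (simp add: orthogonal_transformation_def)
  have diff: "r' $ i - r' $ j = c *\<^sub>R A (r $ i - r $ j)" for i j
    unfolding f[symmetric] f_eq A.diff by (simp add: scaleR_diff_right)
  have mid: "midline \<rho> = (1/2) *\<^sub>R ((\<rho> $ 3 - \<rho> $ 1) + (\<rho> $ 4 - \<rho> $ 2))" for \<rho> :: "'a ^ 4"
    by (simp add: midline_def algebra_simps)
  have "base r' = c *\<^sub>R A (base r)" unfolding base_def diff ..
  moreover have "midline r' = c *\<^sub>R A (midline r)"
    unfolding mid diff A.scale A.add scaleR_add_right by (simp add: mult.commute)
  moreover have "A v \<bullet> A w = v \<bullet> w" for v w using A by (simp add: orthogonal_transformation_def)
  ultimately show ?thesis using c by (simp add: shift_def)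
qed

lemma orthogonal_plane_unique:
  fixes u v w :: "real ^ 2"
  assumes "u \<noteq> 0" "v \<bullet> u = 0" "w \<bullet> u = 0" "norm v = norm w"
  shows "v = w \<or> v = - w"
proof -
  have *: "\<exists>k. z = k *\<^sub>R vector [- u $ 2, u $ 1]" if "z \<bullet> u = 0" for z :: "real^2"
  proof -
    have z: "z $ 1 * u $ 1 + z $ 2 * u $ 2 = 0" using that by (simp add: inner_vec_def sum_2)
    have "u $ 1 \<noteq> 0 \<or> u $ 2 \<noteq> 0" using assms(1) by (auto simp: vec_eq_iff forall_2)
    then show ?thesis
    proof
      assume "u $ 1 \<noteq> 0"
      then show ?thesis using z by (intro exI[of _ "z $ 2 / u $ 1"]) (auto simp: vec_eq_iff forall_2 field_simps)
    next
      assume "u $ 2 \<noteq> 0"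
      then show ?thesis using z by (intro exI[of _ "- z $ 1 / u $ 2"]) (auto simp: vec_eq_iff forall_2 field_simps)
    qed
  qed
  obtain k k' where k: "v = k *\<^sub>R vector [- u $ 2, u $ 1]" "w = k' *\<^sub>R vector [- u $ 2, u $ 1]"
    using * assms by blast
  have "vector [- u $ 2, u $ 1] \<noteq> (0::real^2)" using assms(1) by (auto simp: vec_eq_iff forall_2)
  then have "\<bar>k\<bar> = \<bar>k'\<bar>" using assms(4) unfolding k by simp
  then show ?thesis unfolding k by (auto simp: abs_if split: if_splits)
qed

lemma orthogonal_mirror: "orthogonal_transformation (mirror 0 n)"
proof (cases "n = 0")
  case True
  then have "mirror 0 n = id" by (simp add: mirror_def fun_eq_iff)
  then show ?thesis by (simp add: orthogonal_transformation_id id_def)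
next
  case False
  then have n: "n \<bullet> n \<noteq> 0" by simp
  have "linear (mirror 0 n)"
    by (rule linearI) (simp_all add: mirror_def inner_add_left add_divide_distrib algebra_simps)
  moreover have "mirror 0 n v \<bullet> mirror 0 n w = v \<bullet> w" for v w
    using n by (simp add: mirror_def inner_diff_left inner_diff_right inner_commute[of n w])
  ultimately show ?thesis unfolding orthogonal_transformation_def by blast
qed

lemma mirror_diff: "mirror c n v - mirror c n w = mirror 0 n (v - w)"
  unfolding mirror_def by (simp add: inner_diff_left algebra_simps diff_divide_distrib)

lemma mirror_normal: "mirror 0 n (k *\<^sub>R n) = - (k *\<^sub>R n)"
  unfolding mirror_def by (cases "n = 0") (simp_all flip: scaleR_left_diff_distrib scaleR_minus_left)

text \<open>
  A similarity carrying the first base to the first base carries the part \<open>p\<close> of the midline orthogonal to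
  the base to plus or minus its counterpart. In the second case a reflection in the line of the base
  repairs the sign.
\<close>

lemma similar_if_same_shape:
  fixes r r' :: "real ^ 2 ^ 4"
  assumes "parallel_bases l r" "parallel_bases l r'" "shift r' = shift r" "height_sq r' = height_sq r"
  shows "(r, r') \<in> same_up_to_similarity"
proof -
  have u: "base r \<noteq> 0" and u': "base r' \<noteq> 0" using assms by (auto simp: parallel_bases_def)
  define c where "c = norm (base r') / norm (base r)"
  have c: "0 < c" using u u' by (simp add: c_def)
  define p where "p \<rho> = - shift \<rho> *\<^sub>R base \<rho> + 1 *\<^sub>R midline \<rho>" for \<rho> :: "real^2^4"
  have orth: "p \<rho> \<bullet> base \<rho> = 0" if "base \<rho> \<noteq> 0" for \<rho>
    using that by (simp add: p_def shift_def inner_simps)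
  have np: "(norm (p \<rho>))^2 = (norm (base \<rho>))^2 * height_sq \<rho>" if "base \<rho> \<noteq> 0" for \<rho>
    unfolding p_def norm_combination[OF that] by simp
  have "norm (c *\<^sub>R base r) = norm (base r')" using u by (simp add: c_def)
  then obtain A where A: "orthogonal_transformation A" and Au: "A (c *\<^sub>R base r) = base r'"
    using orthogonal_transformation_exists by blast
  interpret A: linear A using A by (simp add: orthogonal_transformation_def)
  have inner: "A v \<bullet> A w = v \<bullet> w" for v w using A by (simp add: orthogonal_transformation_def)
  have "(norm (c *\<^sub>R A (p r)))^2 = c^2 * (norm (p r))^2"
    using orthogonal_transformation_norm[OF A] by (simp add: power_mult_distrib)
  also have "\<dots> = (norm (p r'))^2" unfolding np[OF u] np[OF u'] assms(4) c_def using u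
    by (simp add: power_divide)
  finally have "norm (c *\<^sub>R A (p r)) = norm (p r')" by (simp only: power2_eq_iff_nonneg norm_ge_zero)
  moreover have "A (p r) \<bullet> A (c *\<^sub>R base r) = 0" unfolding inner using orth[OF u] by simp
  then have "(c *\<^sub>R A (p r)) \<bullet> base r' = 0" unfolding Au by simp
  ultimately have "c *\<^sub>R A (p r) = p r' \<or> c *\<^sub>R A (p r) = - p r'"
    using orthogonal_plane_unique[OF u' _ orth[OF u']] by blast
  then obtain B where B: "orthogonal_transformation B" "c *\<^sub>R B (base r) = base r'" "c *\<^sub>R B (p r) = p r'"
  proof
    assume "c *\<^sub>R A (p r) = p r'"
    then show ?thesis using that[OF A] Au by (simp add: A.scale)
  next
    assume a: "c *\<^sub>R A (p r) = - p r'"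
    define R where "R = mirror 0 (p r')"
    have R: "orthogonal_transformation R" unfolding R_def by (rule orthogonal_mirror)
    interpret R: linear R using R by (simp add: orthogonal_transformation_def)
    have "R (base r') = base r'" unfolding R_def mirror_def using orth[OF u'] by (simp add: inner_commute)
    moreover have "R (- p r') = p r'" unfolding R_def using mirror_normal[of "p r'" "-1"] by simp
    moreover have "c *\<^sub>R (R \<circ> A) v = R (c *\<^sub>R A v)" for v by (simp only: R.scale comp_apply)
    ultimately show ?thesis
      using that[of "R \<circ> A"] orthogonal_transformation_compose[OF R A] a Au
      by (simp only: A.scale)
  qed
  interpret B: linear B using B by (simp add: orthogonal_transformation_def)
  have m: "midline \<rho> = p \<rho> + shift \<rho> *\<^sub>R base \<rho>" for \<rho> by (simp add: p_def)
  have "c *\<^sub>R B (midline r) = c *\<^sub>R B (p r) + shift r *\<^sub>R (c *\<^sub>R B (base r))"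
    unfolding m[of r] B.add B.scale scaleR_add_right by (simp add: mult.commute)
  also have "\<dots> = midline r'" unfolding B(2,3) m[of r'] assms(3) ..
  finally have Bm: "c *\<^sub>R B (midline r) = midline r'" .
  have comb: "c *\<^sub>R B (a *\<^sub>R base r + b *\<^sub>R midline r) = a *\<^sub>R base r' + b *\<^sub>R midline r'" for a b
    unfolding B.add B.scale B(2)[symmetric] Bm[symmetric] by (simp add: scaleR_add_right mult.commute)
  define f where "f = (\<lambda>v. (r' $ 1 - c *\<^sub>R B (r $ 1)) + c *\<^sub>R B v)"
  have f: "f (r $ i) = r' $ 1 + c *\<^sub>R B (r $ i - r $ 1)" for i
    unfolding f_def B.diff by (simp add: algebra_simps)
  have "\<forall>i. f (r $ i) = r' $ i"
    unfolding forall_4 f parallel_bases_differences[OF assms(1)] comb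
    unfolding parallel_bases_differences[OF assms(2), symmetric] by simp
  moreover have "is_similarity f" unfolding is_similarity_def f_def using c B(1)
    by (intro exI[of _ "r' $ 1 - c *\<^sub>R B (r $ 1)"] exI[of _ c] exI[of _ B]) auto
  ultimately show ?thesis unfolding same_up_to_similarity_def by blast
qed

text \<open>
  The reflection reverses the bases and the exchange reverses them back, while the midline is only
  reflected.
\<close>

lemma mirror_exchange_shape:
  assumes "parallel_bases l r"
  shows "parallel_bases l (mirror_exchange c r)" "shift (mirror_exchange c r) = - shift r"
    "height_sq (mirror_exchange c r) = height_sq r"
proof -
  define u where "u = base r"
  have u: "u \<bullet> u \<noteq> 0" using assms by (simp add: u_def parallel_bases_def)
  define R where "R = mirror 0 u"
  have R: "orthogonal_transformation R" unfolding R_def by (rule orthogonal_mirror)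
  interpret R: linear R using R by (simp add: orthogonal_transformation_def)
  have diff: "mirror c u v - mirror c u w = R (v - w)" for v w unfolding R_def by (rule mirror_diff)
  have Ru: "R (k *\<^sub>R u) = - (k *\<^sub>R u)" for k unfolding R_def by (rule mirror_normal)
  define r' where "r' = mirror_exchange c r"
  have r': "r' $ 1 = mirror c u (r $ 2)" "r' $ 2 = mirror c u (r $ 1)"
    "r' $ 3 = mirror c u (r $ 4)" "r' $ 4 = mirror c u (r $ 3)"
    unfolding r'_def mirror_exchange_def Let_def u_def base_def by simp_all
  have "r $ 1 - r $ 2 = (-1) *\<^sub>R u" by (simp add: u_def base_def)
  then have b: "base r' = u" unfolding base_def r' diff using Ru[of "-1"] by simp
  have "r $ 3 - r $ 4 = (- l) *\<^sub>R u" using assms by (simp add: parallel_bases_def u_def algebra_simps)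
  then have 4: "r' $ 4 - r' $ 3 = l *\<^sub>R base r'" unfolding b r' diff using Ru[of "- l"] by simp
  have m: "midline r' = R (midline r)"
  proof -
    have "midline r' = (1/2) *\<^sub>R ((r' $ 3 - r' $ 1) + (r' $ 4 - r' $ 2))" by (simp add: midline_def algebra_simps)
    also have "\<dots> = R ((1/2) *\<^sub>R ((r $ 4 - r $ 2) + (r $ 3 - r $ 1)))" unfolding r' diff R.add[symmetric] R.scale ..
    also have "(1/2) *\<^sub>R ((r $ 4 - r $ 2) + (r $ 3 - r $ 1)) = midline r" by (simp add: midline_def algebra_simps)
    finally show ?thesis .
  qed
  have i2: "R v \<bullet> R v = v \<bullet> v" for v using R by (simp add: orthogonal_transformation_def)
  have i1: "R v \<bullet> u = - (v \<bullet> u)" for v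
  proof -
    have "R v \<bullet> R (1 *\<^sub>R u) = v \<bullet> u" using R by (simp add: orthogonal_transformation_def)
    then show ?thesis unfolding Ru by simp
  qed
  have s: "shift r' = - shift r" unfolding shift_def b m i1 by (simp add: u_def)
  have h: "height_sq r' = height_sq r" unfolding height_sq_def s unfolding b m i2 by (simp add: u_def)
  show "parallel_bases l (mirror_exchange c r)" "shift (mirror_exchange c r) = - shift r"
    "height_sq (mirror_exchange c r) = height_sq r"
    using assms 4 s h b unfolding r'_def[symmetric] parallel_bases_def by (auto simp: u_def)
qed

lemma trapezoid_exists:
  assumes "0 < q"
  obtains r :: "real ^ 2 ^ 4" where "parallel_bases l r" "shift r = t" "height_sq r = q"
proof -
  define r :: "real ^ 2 ^ 4" where "r = vector [vector [- 1/2, 0], vector [1/2, 0],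
    vector [t - l/2, sqrt q], vector [t + l/2, sqrt q]]"
  have b: "base r = vector [1, 0]" by (simp add: base_def r_def vec_eq_iff forall_2)
  have m: "midline r = vector [t, sqrt q]" by (simp add: midline_def r_def vec_eq_iff forall_2)
  have s: "shift r = t" by (simp add: shift_def b m inner_vec_def sum_2)
  have h: "height_sq r = q" using assms by (simp add: height_sq_def s b m inner_vec_def sum_2 power2_eq_square)
  have "r $ 4 - r $ 3 = l *\<^sub>R base r" unfolding b by (simp add: r_def vec_eq_iff forall_2)
  moreover have "base r \<noteq> 0" unfolding b by (simp add: vec_eq_iff forall_2)
  ultimately show ?thesis using that[of r] s h assms by (auto simp: parallel_bases_def)
qed

section \<open>Trapezoids, rhombi and diagonals\<close>

lemma trapezoid_if_parallel_bases:
  assumes "parallel_bases l r" "l \<noteq> 0"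
  shows "trapezoid (r $ 1) (r $ 2) (r $ 3) (r $ 4)"
proof -
  have u: "base r \<noteq> 0" and r4: "r $ 4 - r $ 3 = l *\<^sub>R base r" using assms by (auto simp: parallel_bases_def)
  have neq: "r $ 1 \<noteq> r $ 2" "r $ 3 \<noteq> r $ 4" using u r4 assms(2) by (auto simp: base_def)
  have "{r $ 1, r $ 2, r $ 3, r $ 4} = range (\<lambda>i. r $ i)" unfolding UNIV_4 by simp
  then have nc: "\<not> collinear {r $ 1, r $ 2, r $ 3, r $ 4}" using noncollinear_if_parallel_bases[OF assms(1)] by simp
  have line: "affine hull {a, b} = {a + k *\<^sub>R (b - a) | k. True}" for a b :: "real^2"
    by (auto simp: affine_hull_2_alt image_def)
  have "affine hull {r $ 3, r $ 4} = (+) (r $ 3 - r $ 1) ` (affine hull {r $ 1, r $ 2})"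
  proof (intro equalityI subsetI)
    fix v assume "v \<in> affine hull {r $ 3, r $ 4}"
    then obtain k where "v = r $ 3 + k *\<^sub>R (l *\<^sub>R base r)" unfolding line r4 by blast
    then have "v = r $ 3 + (k * l) *\<^sub>R base r" by simp
    then show "v \<in> (+) (r $ 3 - r $ 1) ` (affine hull {r $ 1, r $ 2})"
      unfolding line by (intro image_eqI[of _ _ "r $ 1 + (k * l) *\<^sub>R base r"]) (auto simp: base_def)
  next
    fix v assume "v \<in> (+) (r $ 3 - r $ 1) ` (affine hull {r $ 1, r $ 2})"
    then obtain k where "v = (r $ 3 - r $ 1) + (r $ 1 + k *\<^sub>R base r)"
      unfolding line base_def by blast
    then have "v = r $ 3 + (k / l) *\<^sub>R (l *\<^sub>R base r)" using assms(2) by simp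
    then show "v \<in> affine hull {r $ 3, r $ 4}" unfolding line r4 by blast
  qed
  then show ?thesis unfolding trapezoid_def affine_parallel_def using neq nc by blast
qed

lemma mem_band_iff:
  assumes "a \<noteq> b"
  shows "v \<in> band a b \<longleftrightarrow> 0 \<le> (v - a) \<bullet> (b - a) \<and> (v - a) \<bullet> (b - a) \<le> (b - a) \<bullet> (b - a)"
proof -
  define n where "n = (b - a) \<bullet> (b - a)"
  have n: "0 < n" using assms by (simp add: n_def)
  show ?thesis unfolding n_def[symmetric]
  proof
    assume "v \<in> band a b"
    then obtain k u where k: "0 \<le> k" "k \<le> 1" and u: "u \<bullet> (b - a) = 0"
      and v: "v = (1 - k) *\<^sub>R a + k *\<^sub>R b + u"
      unfolding band_def closed_segment_def orthogonal_def by blast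
    have "v - a = k *\<^sub>R (b - a) + u" unfolding v by (simp add: algebra_simps)
    then have "(v - a) \<bullet> (b - a) = k * n" by (simp only: inner_add_left inner_scaleR_left u n_def)
    then show "0 \<le> (v - a) \<bullet> (b - a) \<and> (v - a) \<bullet> (b - a) \<le> n" using k n by simp
  next
    assume h: "0 \<le> (v - a) \<bullet> (b - a) \<and> (v - a) \<bullet> (b - a) \<le> n"
    define k where "k = (v - a) \<bullet> (b - a) / n"
    have k: "0 \<le> k" "k \<le> 1" using h n by (auto simp: k_def)
    have "((v - a) - k *\<^sub>R (b - a)) \<bullet> (b - a) = (v - a) \<bullet> (b - a) - k * n"
      unfolding n_def by (simp only: inner_diff_left inner_scaleR_left)
    also have "\<dots> = 0" using n by (simp add: k_def)
    finally have "orthogonal ((v - a) - k *\<^sub>R (b - a)) (b - a)" by (simp add: orthogonal_def)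
    moreover have "(1 - k) *\<^sub>R a + k *\<^sub>R b \<in> closed_segment a b" using k unfolding closed_segment_def by blast
    moreover have "v = ((1 - k) *\<^sub>R a + k *\<^sub>R b) + ((v - a) - k *\<^sub>R (b - a))" by (simp add: algebra_simps)
    ultimately show "v \<in> band a b" unfolding band_def by blast
  qed
qed

text \<open>
  The coordinate \<open>g\<close> along the base, with origin at the midpoint of \<open>[r\<^sub>1, r\<^sub>2]\<close>, turns the bands into
  intervals of lengths \<open>1\<close> and \<open>\<bar>l\<bar>\<close> centred at \<open>0\<close> and \<open>shift r\<close>. The centre of each interval lies
  outside the other one, so neither contains the other; but the distance between the centres is less
  than the sum of the half-lengths, so they meet.
\<close>

lemma semi_balanced_if_shift:
  assumes pb: "parallel_bases l r" and l: "l \<noteq> 0"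
    and t: "1 < 2 * \<bar>shift r\<bar>" "\<bar>l\<bar> < 2 * \<bar>shift r\<bar>" "2 * \<bar>shift r\<bar> < 1 + \<bar>l\<bar>"
  shows "semi_balanced (r $ 1) (r $ 2) (r $ 3) (r $ 4)"
proof -
  define u where "u = base r"
  define n where "n = u \<bullet> u"
  define t where "t = shift r"
  have u: "u \<noteq> 0" using pb by (simp add: parallel_bases_def u_def)
  then have n: "0 < n" by (simp add: n_def)
  define g where "g v = (v - r $ 1) \<bullet> u / n - 1/2" for v
  note dif = parallel_bases_differences[OF pb, folded u_def]
  have neq: "r $ 1 \<noteq> r $ 2" "r $ 3 \<noteq> r $ 4"
    using dif(1,2) u l by auto
  have mu: "midline r \<bullet> u = t * n" using n by (simp add: t_def shift_def u_def n_def)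
  have c1: "(v - r $ 1) \<bullet> u = (g v + 1/2) * n" for v
    using n by (simp add: g_def)
  have c3: "(v - r $ 3) \<bullet> u = (g v - t + l/2) * n" for v
  proof -
    have "(v - r $ 3) \<bullet> u = (v - r $ 1) \<bullet> u - (r $ 3 - r $ 1) \<bullet> u" by (simp add: inner_simps)
    also have "(r $ 3 - r $ 1) \<bullet> u = (1 - l) / 2 * n + t * n"
      unfolding dif inner_add_left by (simp add: mu n_def)
    finally show ?thesis unfolding c1 by (simp add: field_simps)
  qed
  have b12: "v \<in> band (r $ 1) (r $ 2) \<longleftrightarrow> \<bar>g v\<bar> \<le> 1/2" for v
  proof -
    have "v \<in> band (r $ 1) (r $ 2) \<longleftrightarrow> 0 \<le> (g v + 1/2) * n \<and> (g v + 1/2) * n \<le> 1 * n"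
      unfolding mem_band_iff[OF neq(1)] base_def[symmetric] u_def[symmetric] n_def[symmetric] c1 by simp
    also have "\<dots> \<longleftrightarrow> 0 \<le> g v + 1/2 \<and> g v + 1/2 \<le> 1"
      using n by (simp only: zero_le_mult_iff mult_le_cancel_right) auto
    finally show ?thesis by (auto simp: abs_le_iff)
  qed
  have b34: "v \<in> band (r $ 3) (r $ 4) \<longleftrightarrow> \<bar>g v - t\<bar> \<le> \<bar>l\<bar>/2" for v
  proof -
    have r43: "r $ 4 - r $ 3 = l *\<^sub>R u" using dif(2) by simp
    have "v \<in> band (r $ 3) (r $ 4) \<longleftrightarrow> 0 \<le> (l * (g v - t + l/2)) * n \<and> (l * (g v - t + l/2)) * n \<le> (l * l) * n"
      unfolding mem_band_iff[OF neq(2)] r43 inner_scaleR_right inner_scaleR_left c3 by (simp add: n_def mult.assoc)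
    also have "\<dots> \<longleftrightarrow> 0 \<le> l * (g v - t + l/2) \<and> l * (g v - t + l/2) \<le> l * l"
      using n by (simp only: zero_le_mult_iff mult_le_cancel_right) auto
    also have "\<dots> \<longleftrightarrow> \<bar>g v - t\<bar> \<le> \<bar>l\<bar>/2"
      using l by (cases "0 < l") (auto simp: zero_le_mult_iff mult_le_cancel_left abs_if)
    finally show ?thesis .
  qed
  have gex: "\<exists>v. g v = k" for k
    using n by (intro exI[of _ "r $ 1 + (k + 1/2) *\<^sub>R u"]) (simp add: g_def n_def)
  note t = assms(3-5)[folded t_def]
  have "\<not> band (r $ 1) (r $ 2) \<subseteq> band (r $ 3) (r $ 4)"
  proof
    assume sub: "band (r $ 1) (r $ 2) \<subseteq> band (r $ 3) (r $ 4)"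
    obtain v where "g v = - sgn t / 2" using gex by blast
    then show False using subsetD[OF sub, of v] t unfolding b12 b34 by (auto simp: abs_if sgn_if split: if_splits)
  qed
  moreover have "\<not> band (r $ 3) (r $ 4) \<subseteq> band (r $ 1) (r $ 2)"
  proof
    assume sub: "band (r $ 3) (r $ 4) \<subseteq> band (r $ 1) (r $ 2)"
    obtain v where "g v = t" using gex by blast
    then show False using subsetD[OF sub, of v] t unfolding b12 b34 by (auto simp: abs_if split: if_splits)
  qed
  moreover have "band (r $ 1) (r $ 2) \<inter> band (r $ 3) (r $ 4) \<noteq> {}"
  proof -
    obtain v where "g v = sgn t / 2" using gex by blast
    then have "v \<in> band (r $ 1) (r $ 2) \<inter> band (r $ 3) (r $ 4)"
      using t unfolding Int_iff b12 b34 by (auto simp: abs_if sgn_if split: if_splits)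
    then show ?thesis by blast
  qed
  ultimately show ?thesis unfolding semi_balanced_def balanced_def unbalanced_def by blast
qed

text \<open>
  One of \<open>(1 + l) / 2\<close> and \<open>(1 - l) / 2\<close> is \<open>0\<close>, so the two terms of its pair sum are equal, and the right-hand
  side is twice the inverse cube of \<open>1\<close>.
\<close>

lemma admissible_rhombus:
  assumes "l = 1 \<or> l = -1" "admissible l t q" "0 < q"
  shows "t^2 + q = 1"
proof -
  have "0 < t^2 + q" using assms(3) by (simp add: add_nonneg_pos)
  moreover have "attraction (t^2 + q) = attraction 1"
    using assms(1,2) by (auto simp: admissible_def pair_sum_def)
  ultimately show ?thesis using attraction_less[of 1 "t^2 + q"] attraction_less[of "t^2 + q" 1]
    by (cases "t^2 + q" "1::real" rule: linorder_cases) auto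
qed

lemma rhombus_if_equal_bases:
  assumes pb: "parallel_bases l r" and l: "l = 1 \<or> l = -1"
    and a: "admissible l (shift r) (height_sq r)"
  shows "rhombus (r $ 1) (r $ 2) (r $ 3) (r $ 4) \<or> rhombus (r $ 1) (r $ 2) (r $ 4) (r $ 3)"
proof -
  have th: "(shift r)^2 + height_sq r = 1" using admissible_rhombus[OF l a] pb by (simp add: parallel_bases_def)
  have n: "norm v = norm (base r)" if "(norm v)^2 = (norm (base r))^2 * 1" for v
    using that by (simp add: power2_eq_iff_nonneg)
  have r4: "r $ 4 - r $ 3 = l *\<^sub>R (r $ 2 - r $ 1)" using pb by (simp add: parallel_bases_def base_def)
  note d = parallel_bases_distances[OF pb]
  have d12: "dist (r $ 1) (r $ 2) = norm (base r)" "dist (r $ 3) (r $ 4) = norm (base r)"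
    unfolding dist_norm norm_minus_commute[of "r $ 1"] norm_minus_commute[of "r $ 3" "r $ 4"]
    by (rule n, use d(1,2) l in auto)+
  from l show ?thesis
  proof
    assume l: "l = 1"
    have "norm (r $ 3 - r $ 1) = norm (base r)" "norm (r $ 4 - r $ 2) = norm (base r)"
      by (rule n, use d(3,6) l th in simp)+
    then have "rhombus (r $ 1) (r $ 2) (r $ 4) (r $ 3)" unfolding rhombus_def
      using noncollinear_base_apex[OF pb, of 4] r4 l d12
      by (simp add: dist_norm norm_minus_commute)
    then show ?thesis ..
  next
    assume l: "l = -1"
    have "norm (r $ 4 - r $ 1) = norm (base r)" "norm (r $ 3 - r $ 2) = norm (base r)"
      by (rule n, use d(4,5) l th in simp)+
    moreover have "r $ 2 - r $ 1 = r $ 3 - r $ 4" using r4 l by (simp add: algebra_simps)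
    ultimately have "rhombus (r $ 1) (r $ 2) (r $ 3) (r $ 4)" unfolding rhombus_def
      using noncollinear_base_apex[OF pb, of 3] d12
      by (simp add: dist_norm norm_minus_commute)
    then show ?thesis ..
  qed
qed

lemma mem_closed_segment_iff:
  "v \<in> closed_segment a b \<longleftrightarrow> (\<exists>k. 0 \<le> k \<and> k \<le> 1 \<and> v = a + k *\<^sub>R (b - a))"
  unfolding closed_segment_def by (auto simp: algebra_simps)

text \<open>
  The sign of \<open>l\<close> tells which of the pairs of segments are opposite legs. A common
  point of two opposite sides would be a linear relation between \<open>base r\<close> and \<open>midline r\<close>; for the legs it forces
  \<open>a (1 - \<bar>l\<bar>) = 1\<close> with \<open>0 \<le> a \<le> 1\<close>.
\<close>

lemma disjoint_segments:
  assumes pb: "parallel_bases l r"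
  shows "closed_segment (r $ 1) (r $ 2) \<inter> closed_segment (r $ 3) (r $ 4) = {}"
    "0 < l \<Longrightarrow> closed_segment (r $ 1) (r $ 3) \<inter> closed_segment (r $ 2) (r $ 4) = {}"
    "l < 0 \<Longrightarrow> closed_segment (r $ 1) (r $ 4) \<inter> closed_segment (r $ 2) (r $ 3) = {}"
proof -
  have u: "base r \<noteq> 0" "0 < height_sq r" using pb by (auto simp: parallel_bases_def)
  note d = parallel_bases_differences[OF pb] and ceq = combination_eq_iff[OF u]
  show "closed_segment (r $ 1) (r $ 2) \<inter> closed_segment (r $ 3) (r $ 4) = {}"
  proof (rule ccontr)
    assume "\<not> ?thesis"
    then obtain a b where "r $ 1 + a *\<^sub>R (r $ 2 - r $ 1) = r $ 3 + b *\<^sub>R (r $ 4 - r $ 3)"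
      by (fastforce simp: mem_closed_segment_iff)
    then have "r $ 3 - r $ 1 = a *\<^sub>R (r $ 2 - r $ 1) - b *\<^sub>R (r $ 4 - r $ 3)" by (simp add: algebra_simps)
    then have "((1 - l) / 2) *\<^sub>R base r + 1 *\<^sub>R midline r = (a - b * l) *\<^sub>R base r + 0 *\<^sub>R midline r"
      unfolding d by (simp add: algebra_simps)
    then show False unfolding ceq by simp
  qed
  show "closed_segment (r $ 1) (r $ 3) \<inter> closed_segment (r $ 2) (r $ 4) = {}" if l: "0 < l"
  proof (rule ccontr)
    assume "\<not> ?thesis"
    then obtain a b where ab: "0 \<le> a" "a \<le> 1" "r $ 1 + a *\<^sub>R (r $ 3 - r $ 1) = r $ 2 + b *\<^sub>R (r $ 4 - r $ 2)"
      by (fastforce simp: mem_closed_segment_iff)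
    then have "a *\<^sub>R (r $ 3 - r $ 1) = (r $ 2 - r $ 1) + b *\<^sub>R (r $ 4 - r $ 2)" by (simp add: algebra_simps)
    then have "(a * ((1 - l) / 2)) *\<^sub>R base r + a *\<^sub>R midline r = (1 + b * (- (1 - l) / 2)) *\<^sub>R base r + b *\<^sub>R midline r"
      unfolding d scaleR_add_right scaleR_add_left by simp
    then have "a * (1 - l) = 1" unfolding ceq by (auto simp: field_simps)
    then have "a - a * l = 1" by (simp add: algebra_simps)
    moreover have "0 \<le> a * l" using ab l by simp
    ultimately have "a = 1" "a * l = 0" using ab by linarith+
    then show False using l by simp
  qed
  show "closed_segment (r $ 1) (r $ 4) \<inter> closed_segment (r $ 2) (r $ 3) = {}" if l: "l < 0"
  proof (rule ccontr)
    assume "\<not> ?thesis"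
    then obtain a b where ab: "0 \<le> a" "a \<le> 1" "r $ 1 + a *\<^sub>R (r $ 4 - r $ 1) = r $ 2 + b *\<^sub>R (r $ 3 - r $ 2)"
      by (fastforce simp: mem_closed_segment_iff)
    then have "a *\<^sub>R (r $ 4 - r $ 1) = (r $ 2 - r $ 1) + b *\<^sub>R (r $ 3 - r $ 2)" by (simp add: algebra_simps)
    then have "(a * ((1 + l) / 2)) *\<^sub>R base r + a *\<^sub>R midline r = (1 + b * (- (1 + l) / 2)) *\<^sub>R base r + b *\<^sub>R midline r"
      unfolding d scaleR_add_right scaleR_add_left by simp
    then have "a * (1 + l) = 1" unfolding ceq by (auto simp: field_simps)
    then have "a + a * l = 1" by (simp add: algebra_simps)
    moreover have "a * l \<le> 0" using ab l by (simp add: mult_nonneg_nonpos)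
    ultimately have "a = 1" "a * l = 0" using ab by linarith+
    then show False using l by simp
  qed
qed

text \<open>
  Of the three ways to split the four bodies into two pairs, two are excluded by disjointness.
\<close>

lemma same_diagonal_cases:
  assumes pb: "parallel_bases l r" and l: "l \<noteq> 0" and diag: "on_same_diagonal r i j"
  shows "(0 < l \<and> {i, j} \<in> {{1, 4}, {2, 3}}) \<or> (l < 0 \<and> {i, j} \<in> {{1, 3}, {2, 4}})"
proof -
  obtain k h where kh: "{i, j, k, h} = UNIV"
    and meet: "closed_segment (r $ i) (r $ j) \<inter> closed_segment (r $ k) (r $ h) \<noteq> {}"
    using diag unfolding on_same_diagonal_def by blast
  have three: "{a, b, c} \<noteq> UNIV" for a b c :: 4
  proof
    assume "{a, b, c} = UNIV"
    then have "card {a, b, c} = 4" by simp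
    moreover have "card {a, b, c} \<le> 3" by (simp add: card_insert_if)
    ultimately show False by simp
  qed
  have "i \<noteq> j" "k \<notin> {i, j}" "h \<notin> {i, j}"
    using kh three[of i k h] three[of i j h] three[of i j k] by (auto simp: insert_commute)
  then have compl: "{k, h} = UNIV - {i, j}" using kh by blast
  define seg where "seg A = convex hull ((\<lambda>n. r $ n) ` A)" for A
  have seg: "closed_segment (r $ a) (r $ b) = seg {a, b}" for a b
    by (simp add: seg_def segment_convex_hull)
  have meet: "seg {i, j} \<inter> seg (UNIV - {i, j}) \<noteq> {}" using meet unfolding seg compl .
  note dis = disjoint_segments[OF pb, unfolded seg]
  have c: "UNIV - {1, 2} = {3, 4 :: 4}" "UNIV - {3, 4} = {1, 2 :: 4}" "UNIV - {1, 3} = {2, 4 :: 4}"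
    "UNIV - {2, 4} = {1, 3 :: 4}" "UNIV - {1, 4} = {2, 3 :: 4}" "UNIV - {2, 3} = {1, 4 :: 4}"
    unfolding UNIV_4 by auto
  consider "{i, j} = {1, 2}" | "{i, j} = {3, 4}" | "{i, j} = {1, 3}" | "{i, j} = {2, 4}"
    | "{i, j} = {1, 4}" | "{i, j} = {2, 3}"
    using exhaust_4[of i] exhaust_4[of j] \<open>i \<noteq> j\<close> by (elim disjE) (simp_all add: insert_commute)
  then show ?thesis
  proof cases
    case 1
    then show ?thesis using meet dis(1) c by simp
  next
    case 2
    then show ?thesis using meet dis(1) c by (simp add: Int_commute)
  next
    case 3
    then show ?thesis using meet dis(2) c l by (cases "0 < l") auto
  next
    case 4
    then show ?thesis using meet dis(2) c l by (cases "0 < l") (auto simp: Int_commute)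
  next
    case 5
    then show ?thesis using meet dis(3) c l by (cases "0 < l") auto
  next
    case 6
    then show ?thesis using meet dis(3) c l by (cases "0 < l") (auto simp: Int_commute)
  qed
qed

section \<open>The two configurations\<close>

theorem theorem2:
  fixes x y :: real
  assumes "x \<noteq> 0" and "y \<noteq> 0"
  shows
    "let m = (vector [x, -x, y, -y] :: real ^ 4);
         C = planar_noncollinear_central m
     in card (C // (same_up_to_similarity \<inter> C \<times> C)) = 2 \<and>
        (\<forall>r \<in> C. trapezoid (r $ 1) (r $ 2) (r $ 3) (r $ 4) \<and>
                 semi_balanced (r $ 1) (r $ 2) (r $ 3) (r $ 4)) \<and>
        (\<forall>r \<in> C. \<forall>r' \<in> C. (r, r') \<notin> same_up_to_similarity \<longrightarrow>
            (\<exists>c. (mirror_exchange c r, r') \<in> same_up_to_similarity)) \<and>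
        (x = y \<or> x = - y \<longrightarrow>
            (\<forall>r \<in> C. rhombus (r $ 1) (r $ 2) (r $ 3) (r $ 4) \<or>
                     rhombus (r $ 1) (r $ 2) (r $ 4) (r $ 3))) \<and>
        (\<bar>x\<bar> > \<bar>y\<bar> \<longrightarrow> (\<forall>r \<in> C. dist (r $ 1) (r $ 2) < dist (r $ 3) (r $ 4))) \<and>
        (\<bar>y\<bar> > \<bar>x\<bar> \<longrightarrow> (\<forall>r \<in> C. dist (r $ 3) (r $ 4) < dist (r $ 1) (r $ 2))) \<and>
        (\<forall>r \<in> C. \<forall>i j. on_same_diagonal r i j \<longrightarrow> sgn (m $ i) = sgn (m $ j))"
proof -
  define l where "l = - x / y"
  have l: "l \<noteq> 0" and x: "x = - l * y" using assms by (auto simp: l_def)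
  define m :: "real ^ 4" where "m = vector [x, -x, y, -y]"
  define C where "C = planar_noncollinear_central m"
  obtain t\<^sub>0 where "\<exists>q\<^sub>0. 0 < t\<^sub>0 \<and> 0 < q\<^sub>0 \<and> 1 < 2 * t\<^sub>0 \<and> \<bar>l\<bar> < 2 * t\<^sub>0 \<and> 2 * t\<^sub>0 < 1 + \<bar>l\<bar> \<and>
    (\<forall>t q. 0 < q \<longrightarrow> (admissible l t q \<longleftrightarrow> \<bar>t\<bar> = t\<^sub>0 \<and> q = q\<^sub>0))"
    using admissible_unique_solution[OF l] ..
  then obtain q\<^sub>0 where solution: "0 < t\<^sub>0 \<and> 0 < q\<^sub>0 \<and> 1 < 2 * t\<^sub>0 \<and> \<bar>l\<bar> < 2 * t\<^sub>0 \<and> 2 * t\<^sub>0 < 1 + \<bar>l\<bar> \<and>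
    (\<forall>t q. 0 < q \<longrightarrow> (admissible l t q \<longleftrightarrow> \<bar>t\<bar> = t\<^sub>0 \<and> q = q\<^sub>0))" ..
  then have t\<^sub>0_pos: "0 < t\<^sub>0" and q\<^sub>0: "0 < q\<^sub>0"
    and t\<^sub>0: "1 < 2 * t\<^sub>0" "\<bar>l\<bar> < 2 * t\<^sub>0" "2 * t\<^sub>0 < 1 + \<bar>l\<bar>" by simp_all
  have adm: "admissible l t q \<longleftrightarrow> \<bar>t\<bar> = t\<^sub>0 \<and> q = q\<^sub>0" if "0 < q" for t q
    using solution that by (elim conjE allE impE)
  have C: "r \<in> C \<longleftrightarrow> parallel_bases l r \<and> \<bar>shift r\<bar> = t\<^sub>0 \<and> height_sq r = q\<^sub>0" for r
    unfolding C_def m_def planar_noncollinear_central_iff[OF assms(2) l x]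
  proof (rule conj_cong[OF refl])
    assume "parallel_bases l r"
    then show "admissible l (shift r) (height_sq r) \<longleftrightarrow> \<bar>shift r\<bar> = t\<^sub>0 \<and> height_sq r = q\<^sub>0"
      by (intro adm) (simp add: parallel_bases_def)
  qed
  have pb: "parallel_bases l r" if "r \<in> C" for r using that C by blast
  have sim: "(r, r') \<in> same_up_to_similarity \<longleftrightarrow> shift r' = shift r" if "r \<in> C" "r' \<in> C" for r r'
  proof
    assume "shift r' = shift r"
    moreover have "height_sq r' = height_sq r" using that unfolding C by simp
    ultimately show "(r, r') \<in> same_up_to_similarity" by (rule similar_if_same_shape[OF pb pb, OF that])
  qed (rule shift_similar)
  have "card (C // (same_up_to_similarity \<inter> C \<times> C)) = 2"
  proof -
    define cls where "cls t = {r \<in> C. shift r = t}" for t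
    have nonempty: "\<exists>r \<in> C. shift r = t" if "\<bar>t\<bar> = t\<^sub>0" for t
    proof -
      obtain r :: "real ^ 2 ^ 4" where "parallel_bases l r" "shift r = t" "height_sq r = q\<^sub>0"
        by (rule trapezoid_exists[OF q\<^sub>0, of l t])
      then show ?thesis using that C by blast
    qed
    have "(same_up_to_similarity \<inter> C \<times> C) `` {r} = cls (shift r)" if "r \<in> C" for r
      unfolding cls_def using that sim[OF that] by blast
    then have "C // (same_up_to_similarity \<inter> C \<times> C) = (\<lambda>r. cls (shift r)) ` C"
      unfolding quotient_def by blast
    also have "\<dots> = cls ` (shift ` C)" by auto
    also have "shift ` C = {t\<^sub>0, - t\<^sub>0}"
    proof
      show "shift ` C \<subseteq> {t\<^sub>0, - t\<^sub>0}" by (auto simp: C)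
      have "t \<in> shift ` C" if "\<bar>t\<bar> = t\<^sub>0" for t using nonempty[OF that] by blast
      from this[of "t\<^sub>0"] this[of "- t\<^sub>0"] show "{t\<^sub>0, - t\<^sub>0} \<subseteq> shift ` C" using t\<^sub>0_pos by simp
    qed
    finally have "C // (same_up_to_similarity \<inter> C \<times> C) = {cls t\<^sub>0, cls (- t\<^sub>0)}" by simp
    moreover have "cls t\<^sub>0 \<noteq> cls (- t\<^sub>0)"
    proof -
      obtain r where "r \<in> C" "shift r = t\<^sub>0" using nonempty[of "t\<^sub>0"] t\<^sub>0_pos by auto
      then have "r \<in> cls t\<^sub>0" "r \<notin> cls (- t\<^sub>0)" using t\<^sub>0_pos by (simp_all add: cls_def)
      then show ?thesis by blast
    qed
    ultimately show ?thesis by simp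
  qed
  moreover have "\<forall>r \<in> C. trapezoid (r $ 1) (r $ 2) (r $ 3) (r $ 4) \<and>
      semi_balanced (r $ 1) (r $ 2) (r $ 3) (r $ 4)"
  proof (intro ballI conjI)
    fix r assume r: "r \<in> C"
    show "trapezoid (r $ 1) (r $ 2) (r $ 3) (r $ 4)" by (rule trapezoid_if_parallel_bases[OF pb[OF r] l])
    have "\<bar>shift r\<bar> = t\<^sub>0" using r C by blast
    then show "semi_balanced (r $ 1) (r $ 2) (r $ 3) (r $ 4)"
      using t\<^sub>0 by (intro semi_balanced_if_shift[OF pb[OF r] l]) simp_all
  qed
  moreover have "\<forall>r \<in> C. \<forall>r' \<in> C. (r, r') \<notin> same_up_to_similarity \<longrightarrow>
      (\<exists>c. (mirror_exchange c r, r') \<in> same_up_to_similarity)"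
  proof (intro ballI impI exI)
    fix r r' assume r: "r \<in> C" "r' \<in> C" and "(r, r') \<notin> same_up_to_similarity"
    then have "shift r' \<noteq> shift r" using sim by blast
    moreover have "\<bar>shift r'\<bar> = \<bar>shift r\<bar>" "height_sq r' = height_sq r" using r unfolding C by simp_all
    ultimately have "shift r' = - shift r" "height_sq r' = height_sq r" by (simp_all add: abs_eq_iff)
    then show "(mirror_exchange 0 r, r') \<in> same_up_to_similarity"
      using mirror_exchange_shape[OF pb[OF r(1)], of 0]
      by (intro similar_if_same_shape[OF _ pb[OF r(2)]]) auto
  qed
  moreover have "x = y \<or> x = - y \<longrightarrow> (\<forall>r \<in> C. rhombus (r $ 1) (r $ 2) (r $ 3) (r $ 4) \<or>
      rhombus (r $ 1) (r $ 2) (r $ 4) (r $ 3))"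
  proof (intro impI ballI)
    fix r assume xy: "x = y \<or> x = - y" and r: "r \<in> C"
    have "l = 1 \<or> l = -1" using xy assms by (auto simp: l_def)
    moreover have "admissible l (shift r) (height_sq r)" using r adm[OF q\<^sub>0] unfolding C by simp
    ultimately show "rhombus (r $ 1) (r $ 2) (r $ 3) (r $ 4) \<or> rhombus (r $ 1) (r $ 2) (r $ 4) (r $ 3)"
      using rhombus_if_equal_bases[OF pb[OF r]] by blast
  qed
  moreover
  have base_lengths: "dist (r $ 3) (r $ 4) = \<bar>l\<bar> * dist (r $ 1) (r $ 2) \<and> 0 < dist (r $ 1) (r $ 2)"
    if "r \<in> C" for r
  proof -
    have "r $ 2 - r $ 1 \<noteq> 0" "r $ 4 - r $ 3 = l *\<^sub>R (r $ 2 - r $ 1)"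
      using pb[OF that] unfolding parallel_bases_def base_def by auto
    then show ?thesis
      unfolding dist_norm norm_minus_commute[of "r $ 3" "r $ 4"] norm_minus_commute[of "r $ 1" "r $ 2"] by simp
  qed
  have "\<bar>x\<bar> = \<bar>l\<bar> * \<bar>y\<bar>" unfolding x by (simp add: abs_mult)
  then have "\<bar>x\<bar> > \<bar>y\<bar> \<longrightarrow> 1 < \<bar>l\<bar>" "\<bar>y\<bar> > \<bar>x\<bar> \<longrightarrow> \<bar>l\<bar> < 1"
    using assms(2) by (simp_all add: mult_less_cancel_right1 mult_less_cancel_right2)
  then have "\<bar>x\<bar> > \<bar>y\<bar> \<longrightarrow> (\<forall>r \<in> C. dist (r $ 1) (r $ 2) < dist (r $ 3) (r $ 4))"
    "\<bar>y\<bar> > \<bar>x\<bar> \<longrightarrow> (\<forall>r \<in> C. dist (r $ 3) (r $ 4) < dist (r $ 1) (r $ 2))"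
    using base_lengths by (simp_all add: mult_less_cancel_right1 mult_less_cancel_right2)
  moreover have "\<forall>r \<in> C. \<forall>i j. on_same_diagonal r i j \<longrightarrow> sgn (m $ i) = sgn (m $ j)"
  proof (intro ballI allI impI)
    fix r i j assume "r \<in> C" and "on_same_diagonal r i j"
    from same_diagonal_cases[OF pb[OF this(1)] l this(2)]
    show "sgn (m $ i) = sgn (m $ j)" unfolding m_def
      by (auto simp: doubleton_eq_iff x sgn_mult)
  qed
  ultimately show ?thesis unfolding Let_def m_def[symmetric] C_def[symmetric] by (intro conjI)
qed

end
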